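(* Let $\mathcal A$ be a unital C$^*$-algebra and let $\{x_1,\ldots,x_n\}$ and $\{y_1,\ldots,y_p\}$ be two finite families of self-adjoint elements each of which generates $\mathcal A$ as a C$^*$-algebra. Then $\mathfrak K_{top}^{(2)}(x_1,\ldots,x_n)=\mathfrak K_{top}^{(2)}(y_1,\ldots,y_p)$.
   Context: Microstates. Let $\mathcal A$ be a unital C$^*$-algebra and $x_1,\dots,x_n,y_1,\dots,y_m$ self-adjoint elements of $\mathcal A$. Let $\{P_r\}_{r\ge1}$ enumerate all noncommutative polynomials in the indeterminates $X_1,\dots,X_n,Y_1,\dots,Y_m$ whose coefficients have rational real and imaginary parts (constants allowed). $\mathcal M_k^{s.a.}(\mathbb C)$ is the set of self-adjoint $k\times k$ complex matrices and $\tau_k=\frac1k\mathrm{Tr}$. For $R,\epsilon>0$ and $r,k\in\mathbb N$, $\Gamma_R^{(top)}(x_1,\dots,x_n:y_1,\dots,y_m;k,\epsilon,P_1,\dots,P_r)$ is the set of $(A_1,\dots,A_n)\in\mathcal M_k^{s.a.}(\mathbb C)^n$ for which there exist $B_1,\dots,B_m\in\mathcal M_k^{s.a.}(\mathbb C)$ with $\max_{i,j}\{\|A_i\|,\|B_j\|\}\le R$ and $\big|\|P_j(A_1,\dots,A_n,B_1,\dots,B_m)\|-\|P_j(x_1,\dots,x_n,y_1,\dots,y_m)\|\big|\le\epsilon$ for $1\le j\le r$. When $m=0$ it is written $\Gamma_R^{(top)}(x_1,\dots,x_n;k,\epsilon,P_1,\dots,P_r)$. Covering numbers. On $\mathcal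 M_k(\mathbb C)^n$ put $\|(A_i)\|_2=(\sum_i\tau_k(A_i^*A_i))^{1/2}$. The $\omega$-orbit ball centred at $(B_i)$ is the set of $(A_i)$ such that some unitary $W\in\mathcal M_k(\mathbb C)$ satisfies $\|(A_i)-(WB_iW^* )\|_2<\omega$; for $\Sigma\subseteq\mathcal M_k(\mathbb C)^n$, $o_2(\Sigma,\omega)$ is the minimal number of $\omega$-orbit balls centred at points of $\Sigma$ covering $\Sigma$. Convention $\log 0=-\infty$. Topological orbit dimension: $\mathfrak K^{(2)}_{top}(x:y;\omega)=\sup_{R>0}\inf_{\epsilon>0,r\in\mathbb N}\limsup_{k\to\infty}\frac{\log o_2(\Gamma_R^{(top)}(x:y;k,\epsilon,P_1,\dots,P_r),\omega)}{k^2}$ and $\mathfrak K_{top}^{(2)}(x:y)=\limsup_{\omega\to0^+}\mathfrak K_{top}^{(2)}(x:y;\omega)$; when $m=0$ the "$:y$" part is omitted. *)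

theory Defs
  imports "HOL-Analysis.Analysis" "HOL-Library.Liminf_Limsup" "Jordan_Normal_Form.Schur_Decomposition"
begin

class cstar_algebra = banach + real_normed_algebra_1 +
  fixes scaleC :: "complex \<Rightarrow> 'a \<Rightarrow> 'a"
    and cstar :: "'a \<Rightarrow> 'a"
  assumes scaleC_add_right: "scaleC c (x + y) = scaleC c x + scaleC c y"
    and scaleC_add_left: "scaleC (c + d) x = scaleC c x + scaleC d x"
    and scaleC_scaleC: "scaleC c (scaleC d x) = scaleC (c * d) x"
    and scaleC_one: "scaleC 1 x = x"
    and scaleC_of_real: "scaleC (complex_of_real r) x = scaleR r x"
    and mult_scaleC_left: "scaleC c x * y = scaleC c (x * y)"
    and mult_scaleC_right: "x * scaleC c y = scaleC c (x * y)"
    and norm_scaleC: "norm (scaleC c x) = cmod c * norm x"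
    and cstar_add: "cstar (x + y) = cstar x + cstar y"
    and cstar_mult: "cstar (x * y) = cstar y * cstar x"
    and cstar_scaleC: "cstar (scaleC c x) = scaleC (cnj c) (cstar x)"
    and cstar_cstar: "cstar (cstar x) = x"
    and cstar_identity: "norm (cstar x * x) = (norm x)\<^sup>2"

inductive_set star_subalg_gen :: "'a::cstar_algebra set \<Rightarrow> 'a set" for S where
  gen: "x \<in> S \<Longrightarrow> x \<in> star_subalg_gen S"
| one: "1 \<in> star_subalg_gen S"
| add: "x \<in> star_subalg_gen S \<Longrightarrow> y \<in> star_subalg_gen S \<Longrightarrow> x + y \<in> star_subalg_gen S"
| mult: "x \<in> star_subalg_gen S \<Longrightarrow> y \<in> star_subalg_gen S \<Longrightarrow> x * y \<in> star_subalg_gen S"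
| scale: "x \<in> star_subalg_gen S \<Longrightarrow> scaleC c x \<in> star_subalg_gen S"
| star: "x \<in> star_subalg_gen S \<Longrightarrow> cstar x \<in> star_subalg_gen S"

definition generates_cstar :: "'a::cstar_algebra set \<Rightarrow> bool" where
  "generates_cstar S \<longleftrightarrow> closure (star_subalg_gen S) = UNIV"

text \<open>A noncommutative polynomial in N indeterminates Z_0,...,Z_(N-1) is a finitely
  supported coefficient function on words (lists of letters < N).  The first n letters
  stand for X_1..X_n, the next m for Y_1..Y_m.\<close>
definition ncpolys :: "nat \<Rightarrow> (nat list \<Rightarrow> complex) set" where
  "ncpolys N = {c. finite {w. c w \<noteq> 0}
                  \<and> (\<forall>w. c w \<noteq> 0 \<longrightarrow> set w \<subseteq> {..<N})
                  \<and> (\<forall>w. Re (c w) \<in> \<rat> \<and> Im (c w) \<in> \<rat>)}"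

text \<open>The fixed enumeration P_1, P_2, ... (P r for r >= 1).\<close>
definition Ppoly :: "nat \<Rightarrow> nat \<Rightarrow> (nat list \<Rightarrow> complex)" where
  "Ppoly N r = from_nat_into (ncpolys N) (r - 1)"

definition eval_alg :: "(nat list \<Rightarrow> complex) \<Rightarrow> 'a::cstar_algebra list \<Rightarrow> 'a" where
  "eval_alg c zs = (\<Sum>w\<in>{w. c w \<noteq> 0}. scaleC (c w) (prod_list (map (\<lambda>i. zs ! i) w)))"

definition word_mat :: "nat \<Rightarrow> complex mat list \<Rightarrow> nat list \<Rightarrow> complex mat" where
  "word_mat k As w = foldr (\<lambda>i M. (As ! i) * M) w (1\<^sub>m k)"

definition eval_mat :: "nat \<Rightarrow> (nat list \<Rightarrow> complex) \<Rightarrow> complex mat list \<Rightarrow> complex mat" where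
  "eval_mat k c As = mat k k (\<lambda>(a, b). \<Sum>w\<in>{w. c w \<noteq> 0}. c w * word_mat k As w $$ (a, b))"

definition vec_norm2 :: "complex vec \<Rightarrow> real" where
  "vec_norm2 v = sqrt (\<Sum>i<dim_vec v. (cmod (v $ i))\<^sup>2)"

definition mat_opnorm :: "complex mat \<Rightarrow> real" where
  "mat_opnorm A = Sup {vec_norm2 (A *\<^sub>v v) | v. dim_vec v = dim_col A \<and> vec_norm2 v \<le> 1}"

definition msa :: "nat \<Rightarrow> complex mat set" where
  "msa k = {A. A \<in> carrier_mat k k \<and> mat_adjoint A = A}"

definition mtrace :: "complex mat \<Rightarrow> complex" where
  "mtrace A = (\<Sum>i<dim_row A. A $$ (i, i))"

definition tau :: "nat \<Rightarrow> complex mat \<Rightarrow> complex" where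
  "tau k A = mtrace A / of_nat k"

definition unitary_mat :: "nat \<Rightarrow> complex mat \<Rightarrow> bool" where
  "unitary_mat k W \<longleftrightarrow> W \<in> carrier_mat k k \<and> mat_adjoint W * W = 1\<^sub>m k"

definition tuple_dist2 :: "nat \<Rightarrow> complex mat list \<Rightarrow> complex mat list \<Rightarrow> real" where
  "tuple_dist2 k As Bs = sqrt (\<Sum>i<length As.
      Re (tau k (mat_adjoint (As ! i - Bs ! i) * (As ! i - Bs ! i))))"

definition orbit_ball :: "nat \<Rightarrow> real \<Rightarrow> complex mat list \<Rightarrow> complex mat list set" where
  "orbit_ball k \<omega> Bs = {As. length As = length Bs \<and> (\<forall>i<length As. As ! i \<in> carrier_mat k k)
      \<and> (\<exists>W. unitary_mat k W \<and> tuple_dist2 k As (map (\<lambda>B. W * B * mat_adjoint W) Bs) < \<omega>)}"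

definition orbit_cover_num :: "nat \<Rightarrow> complex mat list set \<Rightarrow> real \<Rightarrow> nat" where
  "orbit_cover_num k \<Sigma> \<omega> =
     Inf {card F | F. finite F \<and> F \<subseteq> \<Sigma> \<and> \<Sigma> \<subseteq> (\<Union>B\<in>F. orbit_ball k \<omega> B)}"

definition elog :: "nat \<Rightarrow> ereal" where
  "elog N = (if N = 0 then -\<infinity> else ereal (ln (real N)))"

definition Gamma_top ::
  "'a::cstar_algebra list \<Rightarrow> 'a list \<Rightarrow> real \<Rightarrow> nat \<Rightarrow> real \<Rightarrow> nat \<Rightarrow> complex mat list set" where
  "Gamma_top xs ys R k \<epsilon> r =
     {As. length As = length xs \<and> set As \<subseteq> msa k \<and>
       (\<exists>Bs. length Bs = length ys \<and> set Bs \<subseteq> msa k \<and>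
          (\<forall>M \<in> set (As @ Bs). mat_opnorm M \<le> R) \<and>
          (\<forall>j\<in>{1..r}.
             \<bar>mat_opnorm (eval_mat k (Ppoly (length xs + length ys) j) (As @ Bs))
               - norm (eval_alg (Ppoly (length xs + length ys) j) (xs @ ys))\<bar> \<le> \<epsilon>))}"

definition K_top_rel_omega :: "'a::cstar_algebra list \<Rightarrow> 'a list \<Rightarrow> real \<Rightarrow> ereal" where
  "K_top_rel_omega xs ys \<omega> =
     (SUP R\<in>{0<..}. INF p\<in>{0<..} \<times> {1..}.
        limsup (\<lambda>k. elog (orbit_cover_num k (Gamma_top xs ys R k (fst p) (snd p)) \<omega>)
                     / ereal (real k ^ 2)))"

definition K_top_rel :: "'a::cstar_algebra list \<Rightarrow> 'a list \<Rightarrow> ereal" where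
  "K_top_rel xs ys = Limsup (at_right 0) (K_top_rel_omega xs ys)"

definition K_top :: "'a::cstar_algebra list \<Rightarrow> ereal" where
  "K_top xs = K_top_rel xs []"

end

theory Submission
  imports Defs
begin

text \<open>
  By symmetry it suffices to bound the orbit dimension of \<open>y\<close> by that of \<open>x\<close>. Choose polynomials
  \<open>Q\<close> with \<open>Q(x) \<approx> y\<close> and then self-adjoint polynomials \<open>S\<close> with \<open>S(y)\<close> so close to \<open>x\<close> that
  \<open>S\<close> maps good microstates of \<open>y\<close> to microstates of \<open>x\<close> and \<open>Q \<circ> S\<close> almost fixes the former in
  operator norm. Since \<open>Q\<close> commutes with unitary conjugation and is Lipschitz for the normalised
  Hilbert-Schmidt norm on operator-norm bounded tuples, with a constant independent of the matrix
  size, pulling back a cover of the microstates of \<open>x\<close> along \<open>S\<close> covers those of \<open>y\<close>, with a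
  radius that does not depend on \<open>S\<close>.
\<close>

subsection \<open>Terms for noncommutative polynomials\<close>

text \<open>The obstacle is the order of the choices: the cut-off and the radius are quantified
  outside the infimum over \<open>\<epsilon>\<close> and \<open>r\<close>. As the precision demanded
  of the microstates of \<open>x\<close> grows, \<open>S\<close> has to change, and nothing bounds
  its degree or Lipschitz constant uniformly. Hence the distance of two tuples is estimated only
  through \<open>Q\<close>, never through \<open>S\<close>. The cut-off for \<open>x\<close> must
  likewise depend neither on \<open>S\<close> nor on the cut-off for \<open>y\<close>: it is read
  off from the norms of \<open>x\<close>, because the norms of the polynomials \<open>S\<close> are
  among those that good microstates of \<open>y\<close> reproduce. That \<open>Q \<circ> S\<close>
  almost fixes a microstate is enforced in the same way, through the norm of
  \<open>Q \<circ> S - Y\<close>. \<open>S\<close> has to be self-adjoint since its values must be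
  microstates, whereas \<open>Q\<close> serves only for estimates. The centre of a covering ball
  need not be an image under \<open>S\<close>, so two microstates of \<open>y\<close> are compared
  through the orbit of a common centre.\<close>

no_notation vec_nth (infixl "$" 90)

text \<open>On syntax trees composition and formal adjoints are structural recursions, and estimates
  are inductions; on coefficient functions they would be convolutions. The passage to
  \<open>ncpolys\<close> is \<open>coeff_fun (nc_monoms t)\<close>.\<close>

datatype nc_term = Var nat | Const complex | Add nc_term nc_term | Mul nc_term nc_term

definition complex_rats :: "complex set" where
  "complex_rats = {c. Re c \<in> \<rat> \<and> Im c \<in> \<rat>}"

fun nc_valid :: "nat \<Rightarrow> nc_term \<Rightarrow> bool" where
  "nc_valid N (Var i) = (i < N)"
| "nc_valid N (Const c) = (c \<in> complex_rats)"
| "nc_valid N (Add s t) = (nc_valid N s \<and> nc_valid N t)"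
| "nc_valid N (Mul s t) = (nc_valid N s \<and> nc_valid N t)"

fun nc_eval :: "nc_term \<Rightarrow> 'a::cstar_algebra list \<Rightarrow> 'a" where
  "nc_eval (Var i) zs = zs ! i"
| "nc_eval (Const c) zs = scaleC c 1"
| "nc_eval (Add s t) zs = nc_eval s zs + nc_eval t zs"
| "nc_eval (Mul s t) zs = nc_eval s zs * nc_eval t zs"

fun nc_mat :: "nat \<Rightarrow> nc_term \<Rightarrow> complex mat list \<Rightarrow> complex mat" where
  "nc_mat k (Var i) As = As ! i"
| "nc_mat k (Const c) As = c \<cdot>\<^sub>m 1\<^sub>m k"
| "nc_mat k (Add s t) As = nc_mat k s As + nc_mat k t As"
| "nc_mat k (Mul s t) As = nc_mat k s As * nc_mat k t As"

fun nc_subst :: "nc_term list \<Rightarrow> nc_term \<Rightarrow> nc_term" where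
  "nc_subst ss (Var i) = ss ! i"
| "nc_subst ss (Const c) = Const c"
| "nc_subst ss (Add s t) = Add (nc_subst ss s) (nc_subst ss t)"
| "nc_subst ss (Mul s t) = Mul (nc_subst ss s) (nc_subst ss t)"

text \<open>Variables are fixed because terms are starred only where they are evaluated at
  self-adjoint tuples.\<close>

fun nc_star :: "nc_term \<Rightarrow> nc_term" where
  "nc_star (Var i) = Var i"
| "nc_star (Const c) = Const (cnj c)"
| "nc_star (Add s t) = Add (nc_star s) (nc_star t)"
| "nc_star (Mul s t) = Mul (nc_star t) (nc_star s)"

fun nc_monoms :: "nc_term \<Rightarrow> (complex \<times> nat list) list" where
  "nc_monoms (Var i) = [(1, [i])]"
| "nc_monoms (Const c) = [(c, [])]"
| "nc_monoms (Add s t) = nc_monoms s @ nc_monoms t"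
| "nc_monoms (Mul s t) =
     concat (map (\<lambda>p. map (\<lambda>q. (fst p * fst q, snd p @ snd q)) (nc_monoms t)) (nc_monoms s))"

text \<open>Expansion into monomials may list a word several times. Here the repetitions are
  collected, and cancellation can make the support smaller than the set of listed words.\<close>

definition coeff_fun :: "(complex \<times> nat list) list \<Rightarrow> nat list \<Rightarrow> complex" where
  "coeff_fun L w = (\<Sum>p\<leftarrow>L. if snd p = w then fst p else 0)"

lemma complex_rats_closed:
  "0 \<in> complex_rats" "1 \<in> complex_rats" "1/2 \<in> complex_rats"
  "a \<in> complex_rats \<Longrightarrow> b \<in> complex_rats \<Longrightarrow> a + b \<in> complex_rats"
  "a \<in> complex_rats \<Longrightarrow> b \<in> complex_rats \<Longrightarrow> a * b \<in> complex_rats"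
  "a \<in> complex_rats \<Longrightarrow> - a \<in> complex_rats"
  "a \<in> complex_rats \<Longrightarrow> cnj a \<in> complex_rats"
  by (auto simp: complex_rats_def)

lemma nc_valid_subst:
  "nc_valid (length ss) t \<Longrightarrow> \<forall>s\<in>set ss. nc_valid N s \<Longrightarrow> nc_valid N (nc_subst ss t)"
  by (induction t) auto

lemma nc_valid_star: "nc_valid N t \<Longrightarrow> nc_valid N (nc_star t)"
  by (induction t) (auto simp: complex_rats_closed)

lemma nc_eval_subst:
  "nc_valid (length ss) t \<Longrightarrow> nc_eval (nc_subst ss t) zs = nc_eval t (map (\<lambda>s. nc_eval s zs) ss)"
  by (induction t) auto

lemma nc_mat_subst:
  "nc_valid (length ss) t \<Longrightarrow> nc_mat k (nc_subst ss t) As = nc_mat k t (map (\<lambda>s. nc_mat k s As) ss)"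
  by (induction t) auto

lemma nc_monoms_valid:
  "nc_valid N t \<Longrightarrow> p \<in> set (nc_monoms t) \<Longrightarrow> fst p \<in> complex_rats \<and> set (snd p) \<subseteq> {..<N}"
proof (induction t arbitrary: p)
  case (Mul s t)
  then obtain q r where "q \<in> set (nc_monoms s)" "r \<in> set (nc_monoms t)"
    "p = (fst q * fst r, snd q @ snd r)" by auto
  with Mul.IH[of q] Mul.IH(2)[of r] Mul.prems(1) show ?case
    by (auto simp: complex_rats_closed)
next
  case (Add s t)
  then show ?case by (cases "p \<in> set (nc_monoms s)") simp_all
qed (auto simp: complex_rats_closed)

lemma coeff_fun_simps:
  "coeff_fun [] w = 0"
  "coeff_fun (p # L) w = (if snd p = w then fst p else 0) + coeff_fun L w"
  by (auto simp: coeff_fun_def)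

lemma coeff_fun_nonzero: "coeff_fun L w \<noteq> 0 \<Longrightarrow> w \<in> snd ` set L"
  by (induction L) (auto simp: coeff_fun_simps split: if_splits)

lemma coeff_fun_in_ncpolys:
  assumes "\<And>p. p \<in> set L \<Longrightarrow> fst p \<in> complex_rats \<and> set (snd p) \<subseteq> {..<N}"
  shows "coeff_fun L \<in> ncpolys N"
proof -
  have "finite {w. coeff_fun L w \<noteq> 0}"
    by (rule finite_subset[of _ "snd ` set L"]) (auto dest: coeff_fun_nonzero)
  moreover have "\<forall>w. coeff_fun L w \<noteq> 0 \<longrightarrow> set w \<subseteq> {..<N}"
    using assms by (force dest: coeff_fun_nonzero)
  moreover have "coeff_fun L w \<in> complex_rats" for w
    using assms by (induction L) (auto simp: coeff_fun_simps complex_rats_closed)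
  ultimately show ?thesis by (auto simp: ncpolys_def complex_rats_def)
qed

text \<open>Additivity of \<open>phi\<close> in the coefficient makes collecting repeated words
  harmless, and it forces \<open>phi 0 w = 0\<close>, so words that cancel contribute nothing. One
  statement serves both \<open>eval_alg\<close> and the entries of \<open>eval_mat\<close>.\<close>

lemma sum_coeff_fun:
  fixes phi :: "complex \<Rightarrow> nat list \<Rightarrow> 'b::ab_group_add"
  assumes add: "\<And>a b w. phi (a + b) w = phi a w + phi b w"
  shows "(\<Sum>w | coeff_fun L w \<noteq> 0. phi (coeff_fun L w) w) = (\<Sum>p\<leftarrow>L. phi (fst p) (snd p))"
proof -
  have z: "phi 0 w = 0" for w using add[of 0 0 w] by simp
  \<comment> \<open>The support can shrink or grow when a monomial is prepended, so the induction
    runs over a fixed finite set \<open>T\<close> containing all listed words.\<close>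
  have *: "(\<Sum>w\<in>T. phi (coeff_fun L w) w) = (\<Sum>p\<leftarrow>L. phi (fst p) (snd p))"
    if "finite T" "snd ` set L \<subseteq> T" for T
    using that
  proof (induction L)
    case (Cons p L)
    have "(\<Sum>w\<in>T. phi (if snd p = w then fst p else 0) w)
        = (\<Sum>w\<in>T. if snd p = w then phi (fst p) w else 0)"
      by (rule sum.cong) (auto simp: z)
    also have "\<dots> = phi (fst p) (snd p)" using Cons.prems by simp
    finally show ?case using Cons by (simp add: coeff_fun_simps add sum.distrib)
  qed (simp add: coeff_fun_simps z)
  have "(\<Sum>w | coeff_fun L w \<noteq> 0. phi (coeff_fun L w) w)
      = (\<Sum>w\<in>snd ` set L. phi (coeff_fun L w) w)"
    by (rule sum.mono_neutral_left) (auto simp: z dest: coeff_fun_nonzero)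
  with *[of "snd ` set L"] show ?thesis by simp
qed

lemma sum_list_concat_product:
  fixes h :: "complex \<times> nat list \<Rightarrow> 'b::semiring_0"
  shows "(\<Sum>p\<leftarrow>concat (map (\<lambda>p. map (g p) ys) xs). h p) = (\<Sum>p\<leftarrow>xs. \<Sum>q\<leftarrow>ys. h (g p q))"
  by (induction xs) (auto simp: o_def)

lemma sum_list_mult_sum_list:
  fixes f :: "'c \<Rightarrow> 'b::semiring_0"
  shows "(\<Sum>p\<leftarrow>xs. f p) * (\<Sum>q\<leftarrow>ys. g q) = (\<Sum>p\<leftarrow>xs. \<Sum>q\<leftarrow>ys. f p * g q)"
  by (induction xs) (auto simp: distrib_right sum_list_const_mult)

lemma nc_eval_monoms:
  "nc_eval t zs = (\<Sum>p\<leftarrow>nc_monoms t. scaleC (fst p) (prod_list (map (\<lambda>i. zs ! i) (snd p))))"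
proof (induction t)
  case (Mul s t)
  then show ?case
    by (simp add: sum_list_concat_product sum_list_mult_sum_list
        mult_scaleC_left mult_scaleC_right scaleC_scaleC mult.commute)
qed (auto simp: scaleC_one)

lemma eval_alg_coeff_fun: "eval_alg (coeff_fun (nc_monoms t)) zs = nc_eval t zs"
  unfolding eval_alg_def nc_eval_monoms
  by (rule sum_coeff_fun[of "\<lambda>c w. scaleC c (prod_list (map (\<lambda>i. zs ! i) w))"])
    (simp add: scaleC_add_left)

lemma word_mat_carrier:
  "\<forall>i\<in>set w. As ! i \<in> carrier_mat k k \<Longrightarrow> word_mat k As w \<in> carrier_mat k k"
  by (induction w) (auto simp: word_mat_def)

lemma word_mat_append:
  "\<forall>i\<in>set (u @ v). As ! i \<in> carrier_mat k k \<Longrightarrow>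
     word_mat k As (u @ v) = word_mat k As u * word_mat k As v"
proof (induction u)
  case Nil
  then have "word_mat k As v \<in> carrier_mat k k" by (simp add: word_mat_carrier)
  then show ?case by (simp add: word_mat_def)
next
  case (Cons i u)
  then have "word_mat k As u \<in> carrier_mat k k" "word_mat k As v \<in> carrier_mat k k"
    by (auto intro: word_mat_carrier)
  with Cons show ?case
    by (simp add: word_mat_def assoc_mult_mat[of _ k k _ k _ k])
qed

lemma nc_mat_carrier:
  "nc_valid (length As) t \<Longrightarrow> set As \<subseteq> carrier_mat k k \<Longrightarrow> nc_mat k t As \<in> carrier_mat k k"
  by (induction t) (auto simp: subset_iff)

lemma index_mult_mat_square:
  assumes "A \<in> carrier_mat k k" "B \<in> carrier_mat k k" "a < k" "b < k"
  shows "(A * B) $$ (a, b) = (\<Sum>l<k. A $$ (a, l) * B $$ (l, b))"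
  using assms by (auto simp: scalar_prod_def atLeast0LessThan)

text \<open>Entrywise, as \<open>eval_mat\<close> is defined entrywise. For products,
  \<open>word_mat_append\<close> turns concatenated words into matrix products, and the inner index
  \<open>l\<close> is summed last.\<close>

lemma nc_mat_monoms:
  assumes "nc_valid (length As) t" "set As \<subseteq> carrier_mat k k" "a < k" "b < k"
  shows "nc_mat k t As $$ (a, b) = (\<Sum>p\<leftarrow>nc_monoms t. fst p * word_mat k As (snd p) $$ (a, b))"
  using assms
proof (induction t arbitrary: a b)
  case (Var i)
  then have "As ! i \<in> carrier_mat k k" by auto
  then show ?case by (simp add: word_mat_def)
next
  case (Add s t)
  then have "nc_mat k s As \<in> carrier_mat k k" "nc_mat k t As \<in> carrier_mat k k"
    by (auto intro: nc_mat_carrier)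
  with Add show ?case by simp
next
  case (Mul s t)
  let ?W = "\<lambda>p. word_mat k As (snd p)"
  have c: "nc_mat k s As \<in> carrier_mat k k" "nc_mat k t As \<in> carrier_mat k k"
    using Mul.prems by (auto intro: nc_mat_carrier)
  have v: "\<forall>i\<in>set (snd p). As ! i \<in> carrier_mat k k"
    if "p \<in> set (nc_monoms s) \<or> p \<in> set (nc_monoms t)" for p
    using that Mul.prems nc_monoms_valid[of "length As" s p] nc_monoms_valid[of "length As" t p]
    by (auto simp: subset_iff)
  have e: "word_mat k As (snd p @ snd q) $$ (a, b) = (\<Sum>l<k. ?W p $$ (a, l) * ?W q $$ (l, b))"
    if "p \<in> set (nc_monoms s)" "q \<in> set (nc_monoms t)" for p q
  proof -
    have "?W p \<in> carrier_mat k k" "?W q \<in> carrier_mat k k"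
      using v[of p] v[of q] that by (simp_all add: word_mat_carrier)
    moreover have "word_mat k As (snd p @ snd q) = ?W p * ?W q"
      using v[of p] v[of q] that by (intro word_mat_append) auto
    ultimately show ?thesis using Mul.prems by (simp only: index_mult_mat_square)
  qed
  have sw: "(\<Sum>l<k. \<Sum>p\<leftarrow>L. f p l) = (\<Sum>p\<leftarrow>L. \<Sum>l<k. f p l)"
    for f :: "complex \<times> nat list \<Rightarrow> nat \<Rightarrow> complex" and L
    by (induction L) (auto simp: sum.distrib)
  have "nc_mat k (Mul s t) As $$ (a, b)
      = (\<Sum>l<k. nc_mat k s As $$ (a, l) * nc_mat k t As $$ (l, b))"
    using c Mul.prems by (simp only: nc_mat.simps index_mult_mat_square)
  also have "\<dots> = (\<Sum>l<k. \<Sum>p\<leftarrow>nc_monoms s. \<Sum>q\<leftarrow>nc_monoms t.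
      fst p * fst q * (?W p $$ (a, l) * ?W q $$ (l, b)))"
    using Mul by (intro sum.cong refl) (simp add: sum_list_mult_sum_list, simp add: mult_ac)
  also have "\<dots> = (\<Sum>p\<leftarrow>nc_monoms s. \<Sum>q\<leftarrow>nc_monoms t.
      fst p * fst q * (\<Sum>l<k. ?W p $$ (a, l) * ?W q $$ (l, b)))"
    by (simp add: sw sum_distrib_left)
  also have "\<dots> = (\<Sum>p\<leftarrow>nc_monoms s. \<Sum>q\<leftarrow>nc_monoms t.
      fst p * fst q * word_mat k As (snd p @ snd q) $$ (a, b))"
    by (intro arg_cong[of _ _ sum_list] map_cong refl) (simp add: e)
  finally show ?case by (simp add: sum_list_concat_product)
qed (simp add: word_mat_def)

lemma eval_mat_coeff_fun:
  assumes "nc_valid (length As) t" "set As \<subseteq> carrier_mat k k"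
  shows "eval_mat k (coeff_fun (nc_monoms t)) As = nc_mat k t As"
proof (rule eq_matI)
  have c: "nc_mat k t As \<in> carrier_mat k k" using assms by (rule nc_mat_carrier)
  show "dim_row (eval_mat k (coeff_fun (nc_monoms t)) As) = dim_row (nc_mat k t As)"
       "dim_col (eval_mat k (coeff_fun (nc_monoms t)) As) = dim_col (nc_mat k t As)"
    using c by (auto simp: eval_mat_def)
  fix a b assume "a < dim_row (nc_mat k t As)" "b < dim_col (nc_mat k t As)"
  then have "a < k" "b < k" using c by auto
  then show "eval_mat k (coeff_fun (nc_monoms t)) As $$ (a, b) = nc_mat k t As $$ (a, b)"
    using sum_coeff_fun[of "\<lambda>c w. c * word_mat k As w $$ (a, b)"] assms
    by (simp add: eval_mat_def nc_mat_monoms distrib_right)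
qed

section \<open>Terms and the enumerated polynomials\<close>

lemma ncpolys_coeff_funE:
  assumes "c \<in> ncpolys N"
  obtains L where "c = coeff_fun L" "\<And>p. p \<in> set L \<Longrightarrow> fst p \<in> complex_rats \<and> set (snd p) \<subseteq> {..<N}"
proof -
  obtain ws where ws: "set ws = {w. c w \<noteq> 0}" "distinct ws"
    using assms finite_distinct_list[of "{w. c w \<noteq> 0}"] by (auto simp: ncpolys_def)
  define L where "L = map (\<lambda>w. (c w, w)) ws"
  have "coeff_fun L w = (\<Sum>v\<leftarrow>ws. if v = w then c v else 0)" for w
    by (simp add: coeff_fun_def L_def o_def cong: if_cong)
  then have "coeff_fun L w = (\<Sum>v | c v \<noteq> 0. if v = w then c v else 0)" for w
    using ws by (simp add: sum_list_distinct_conv_sum_set)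
  moreover have "finite {w. c w \<noteq> 0}" using assms by (simp add: ncpolys_def)
  ultimately have "c = coeff_fun L" by auto
  moreover have "fst p \<in> complex_rats \<and> set (snd p) \<subseteq> {..<N}" if "p \<in> set L" for p
    using that assms ws by (force simp: L_def ncpolys_def complex_rats_def)
  ultimately show ?thesis by (rule that)
qed

lemma nc_monoms_surj:
  assumes "\<And>p. p \<in> set L \<Longrightarrow> fst p \<in> complex_rats \<and> set (snd p) \<subseteq> {..<N}"
  obtains t where "nc_valid N t" "coeff_fun (nc_monoms t) = coeff_fun L"
proof -
  define word where "word w = foldr Mul (map Var w) (Const 1)" for w
  define t where "t = foldr (\<lambda>p. Add (Mul (Const (fst p)) (word (snd p)))) L (Const 0)"
  have w1: "nc_monoms (word w) = [(1, w)]" for w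
    unfolding word_def by (induction w) auto
  have w2: "set w \<subseteq> {..<N} \<Longrightarrow> nc_valid N (word w)" for w
    unfolding word_def by (induction w) (auto simp: complex_rats_closed)
  \<comment> \<open>The base \<open>Const 0\<close> of the fold leaves a monomial with coefficient
    0, which \<open>coeff_fun\<close> does not see.\<close>
  have "nc_monoms t = L @ [(0, [])]"
    unfolding t_def by (induction L) (auto simp: w1)
  then have "coeff_fun (nc_monoms t) = coeff_fun L" by (auto simp: coeff_fun_def)
  moreover have "nc_valid N t"
    using assms unfolding t_def by (induction L) (auto simp: w2 complex_rats_closed)
  ultimately show ?thesis using that by blast
qed

lemma ncpolys_eq: "ncpolys N = (\<lambda>t. coeff_fun (nc_monoms t)) ` {t. nc_valid N t}"
proof (intro equalityI subsetI)
  fix c assume "c \<in> ncpolys N"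
  then obtain L where L: "c = coeff_fun L"
    "\<And>p. p \<in> set L \<Longrightarrow> fst p \<in> complex_rats \<and> set (snd p) \<subseteq> {..<N}"
    by (rule ncpolys_coeff_funE) blast
  from L(2) obtain t where "nc_valid N t" "coeff_fun (nc_monoms t) = coeff_fun L"
    by (rule nc_monoms_surj) blast
  with L(1) show "c \<in> (\<lambda>t. coeff_fun (nc_monoms t)) ` {t. nc_valid N t}" by force
qed (auto intro!: coeff_fun_in_ncpolys dest: nc_monoms_valid)

lemma countable_complex_rats: "countable complex_rats"
proof -
  have "complex_rats \<subseteq> (\<lambda>(a, b). Complex a b) ` (\<rat> \<times> \<rat>)"
  proof
    fix c assume "c \<in> complex_rats"
    then show "c \<in> (\<lambda>(a, b). Complex a b) ` (\<rat> \<times> \<rat>)"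
      by (intro image_eqI[of _ _ "(Re c, Im c)"]) (auto simp: complex_rats_def)
  qed
  then show ?thesis by (rule countable_subset) (intro countable_image countable_SIGMA countable_rat)
qed

text \<open>Countability is what makes \<open>from_nat_into\<close> reach every polynomial, as
  \<open>term_Ppoly\<close> requires.\<close>

lemma countable_ncpolys: "countable (ncpolys N)"
proof -
  have "ncpolys N \<subseteq> coeff_fun ` lists (complex_rats \<times> UNIV)"
  proof
    fix c assume "c \<in> ncpolys N"
    then obtain L where "c = coeff_fun L"
      "\<And>p. p \<in> set L \<Longrightarrow> fst p \<in> complex_rats \<and> set (snd p) \<subseteq> {..<N}"
      by (rule ncpolys_coeff_funE) blast
    then show "c \<in> coeff_fun ` lists (complex_rats \<times> UNIV)" by (auto simp: mem_Times_iff)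
  qed
  then show ?thesis
    by (rule countable_subset) (intro countable_image countable_lists countable_SIGMA countable_complex_rats; simp)
qed

lemma Ppoly_term:
  obtains t where "nc_valid N t" "Ppoly N j = coeff_fun (nc_monoms t)"
proof -
  have "nc_valid N (Const 0)" by (simp add: complex_rats_closed)
  then have "ncpolys N \<noteq> {}" unfolding ncpolys_eq by blast
  then have "Ppoly N j \<in> ncpolys N" unfolding Ppoly_def by (rule from_nat_into)
  then show ?thesis using that unfolding ncpolys_eq by blast
qed

lemma term_Ppoly:
  assumes "nc_valid N t"
  obtains j where "j \<ge> 1" "Ppoly N j = coeff_fun (nc_monoms t)"
proof -
  have "coeff_fun (nc_monoms t) \<in> ncpolys N" using assms unfolding ncpolys_eq by blast
  then obtain i where "from_nat_into (ncpolys N) i = coeff_fun (nc_monoms t)"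
    using from_nat_into_surj[OF countable_ncpolys] by blast
  \<comment> \<open>\<open>Ppoly\<close> shifts its index by one, so position \<open>i\<close> of
    the enumeration is the polynomial with index \<open>Suc i\<close>.\<close>
  then show ?thesis using that[of "Suc i"] by (simp add: Ppoly_def)
qed

subsection \<open>The normalised Hilbert-Schmidt norm\<close>

declare minus_carrier_mat [simp]

lemma mat_adjoint_dim [simp]:
  "dim_row (mat_adjoint A) = dim_col A" "dim_col (mat_adjoint A) = dim_row A"
  by (auto simp: mat_adjoint_def)

lemma mat_adjoint_carrier: "A \<in> carrier_mat n m \<Longrightarrow> mat_adjoint A \<in> carrier_mat m n"
  by (auto intro: carrier_matI)

lemma mat_adjoint_index [simp]:
  "i < dim_col A \<Longrightarrow> j < dim_row A \<Longrightarrow> mat_adjoint A $$ (i, j) = cnj (A $$ (j, i))"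
  by (simp add: mat_adjoint_def mat_of_rows_def)

lemma mat_adjoint_adjoint [simp]: "mat_adjoint (mat_adjoint A) = (A :: complex mat)"
  by (rule eq_matI) auto

lemma mat_adjoint_add:
  "A \<in> carrier_mat n m \<Longrightarrow> B \<in> carrier_mat n m \<Longrightarrow>
     mat_adjoint (A + B) = mat_adjoint A + (mat_adjoint B :: complex mat)"
  by (rule eq_matI) auto

lemma mat_adjoint_smult: "mat_adjoint (c \<cdot>\<^sub>m A) = cnj c \<cdot>\<^sub>m (mat_adjoint A :: complex mat)"
  by (rule eq_matI) auto

lemma mat_adjoint_one [simp]: "mat_adjoint (1\<^sub>m k) = (1\<^sub>m k :: complex mat)"
  by (rule eq_matI) auto

lemma mat_adjoint_mult:
  assumes "A \<in> carrier_mat n m" "B \<in> carrier_mat m l"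
  shows "mat_adjoint (A * B) = mat_adjoint B * (mat_adjoint A :: complex mat)"
proof (rule eq_matI)
  fix i j assume "i < dim_row (mat_adjoint B * mat_adjoint A)" "j < dim_col (mat_adjoint B * mat_adjoint A)"
  then show "mat_adjoint (A * B) $$ (i, j) = (mat_adjoint B * mat_adjoint A) $$ (i, j)"
    using assms by (auto simp: scalar_prod_def mult.commute intro!: sum.cong)
qed (use assms in auto)

definition hs_norm :: "nat \<Rightarrow> complex mat \<Rightarrow> real" where
  "hs_norm k A = sqrt (Re (tau k (mat_adjoint A * A)))"

text \<open>The trace is a sum of squared entries, so \<open>hs_norm\<close> is a scaled Euclidean
  norm on \<open>k * k\<close> coordinates and inherits its norm properties from
  \<open>L2_set\<close>.\<close>

lemma hs_norm_eq_L2_set: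
  assumes "A \<in> carrier_mat k k"
  shows "hs_norm k A = L2_set (\<lambda>(i, j). cmod (A $$ (i, j))) ({..<k} \<times> {..<k}) / sqrt (real k)"
proof -
  have sq: "cnj z * z = (of_real (cmod z))\<^sup>2" for z
    using complex_norm_square[of z] by (simp add: mult.commute)
  have "(mat_adjoint A * A) $$ (i, i) = of_real (\<Sum>l<k. (cmod (A $$ (l, i)))\<^sup>2)" if "i < k" for i
    using assms that sq by (simp add: scalar_prod_def atLeast0LessThan)
  then have "mtrace (mat_adjoint A * A) = of_real (\<Sum>i<k. \<Sum>l<k. (cmod (A $$ (l, i)))\<^sup>2)"
    using assms by (auto simp: mtrace_def)
  then have "tau k (mat_adjoint A * A) = of_real ((\<Sum>i<k. \<Sum>l<k. (cmod (A $$ (l, i)))\<^sup>2) / real k)"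
    by (simp add: tau_def)
  then have "Re (tau k (mat_adjoint A * A)) = (\<Sum>i<k. \<Sum>l<k. (cmod (A $$ (l, i)))\<^sup>2) / real k"
    by (simp only: Re_complex_of_real)
  also have "(\<Sum>i<k. \<Sum>l<k. (cmod (A $$ (l, i)))\<^sup>2)
      = (\<Sum>p\<in>{..<k} \<times> {..<k}. (case p of (i, j) \<Rightarrow> cmod (A $$ (i, j)))\<^sup>2)"
    by (subst sum.swap) (simp add: sum.cartesian_product split_def)
  finally show ?thesis by (simp add: hs_norm_def L2_set_def real_sqrt_divide)
qed

lemma hs_norm_nonneg: "A \<in> carrier_mat k k \<Longrightarrow> 0 \<le> hs_norm k A"
  by (simp add: hs_norm_eq_L2_set)

lemma hs_norm_mono:
  assumes "A \<in> carrier_mat k k" "B \<in> carrier_mat k k"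
    "\<And>i j. i < k \<Longrightarrow> j < k \<Longrightarrow> cmod (A $$ (i, j)) \<le> cmod (B $$ (i, j))"
  shows "hs_norm k A \<le> hs_norm k B"
  using assms by (auto simp: hs_norm_eq_L2_set intro!: divide_right_mono L2_set_mono)

lemma hs_norm_add:
  assumes "A \<in> carrier_mat k k" "B \<in> carrier_mat k k"
  shows "hs_norm k (A + B) \<le> hs_norm k A + hs_norm k B"
proof -
  let ?f = "\<lambda>A (i, j). cmod (A $$ (i, j) :: complex)" and ?I = "{..<k} \<times> {..<k}"
  have "L2_set (?f (A + B)) ?I \<le> L2_set (\<lambda>p. ?f A p + ?f B p) ?I"
    using assms by (intro L2_set_mono) (auto intro: norm_triangle_ineq)
  also have "\<dots> \<le> L2_set (?f A) ?I + L2_set (?f B) ?I" by (rule L2_set_triangle_ineq)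
  finally show ?thesis using assms
    by (simp add: hs_norm_eq_L2_set divide_right_mono flip: add_divide_distrib)
qed

lemma hs_norm_minus_commute:
  assumes "A \<in> carrier_mat k k" "B \<in> carrier_mat k k"
  shows "hs_norm k (A - B) = hs_norm k (B - A)"
  using assms by (intro antisym hs_norm_mono) (auto simp: norm_minus_commute)

lemma hs_norm_triangle:
  assumes "A \<in> carrier_mat k k" "B \<in> carrier_mat k k" "C \<in> carrier_mat k k"
  shows "hs_norm k (A - C) \<le> hs_norm k (A - B) + hs_norm k (B - C)"
proof -
  have "A - C = (A - B) + (B - C)" using assms by (intro eq_matI) auto
  then show ?thesis using assms
    by (simp add: hs_norm_add)
qed

lemma hs_norm_smult:
  assumes "A \<in> carrier_mat k k"
  shows "hs_norm k (c \<cdot>\<^sub>m A) = cmod c * hs_norm k A"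
proof -
  have "L2_set (\<lambda>(i, j). cmod ((c \<cdot>\<^sub>m A) $$ (i, j))) ({..<k} \<times> {..<k})
      = L2_set (\<lambda>p. cmod c * (case p of (i, j) \<Rightarrow> cmod (A $$ (i, j)))) ({..<k} \<times> {..<k})"
    using assms by (intro L2_set_cong) (auto simp: norm_mult)
  then show ?thesis using assms by (simp add: hs_norm_eq_L2_set L2_set_right_distrib)
qed

lemma hs_norm_adjoint:
  assumes "A \<in> carrier_mat k k"
  shows "hs_norm k (mat_adjoint A) = hs_norm k A"
proof -
  have "L2_set (\<lambda>(i, j). cmod (mat_adjoint A $$ (i, j))) ({..<k} \<times> {..<k})
      = L2_set (\<lambda>(i, j). cmod (A $$ (i, j))) ({..<k} \<times> {..<k})"
    unfolding L2_set_def
    using assms by (intro arg_cong[of _ _ sqrt] sum.reindex_bij_witness[of _ prod.swap prod.swap]) auto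
  then show ?thesis using assms mat_adjoint_carrier[OF assms] by (simp add: hs_norm_eq_L2_set)
qed

lemma hs_norm_one: "k > 0 \<Longrightarrow> hs_norm k (1\<^sub>m k) = 1"
  by (simp add: hs_norm_def mtrace_def tau_def)

lemma cmod_entry_le_hs_norm:
  assumes "A \<in> carrier_mat k k" "i < k" "j < k"
  shows "cmod (A $$ (i, j)) \<le> sqrt (real k) * hs_norm k A"
proof -
  have "(\<lambda>(i, j). cmod (A $$ (i, j))) (i, j) \<le> L2_set (\<lambda>(i, j). cmod (A $$ (i, j))) ({..<k} \<times> {..<k})"
    using assms by (intro member_le_L2_set) auto
  then show ?thesis using assms by (simp add: hs_norm_eq_L2_set)
qed

text \<open>An operator norm bound, expressed by what the product rule needs: multiplication by
  \<open>A\<close> on either side is bounded for the Hilbert-Schmidt norm. In this form sums and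
  products are immediate, without norm inequalities for the supremum
  \<open>mat_opnorm\<close>.\<close>

definition hs_bounded :: "nat \<Rightarrow> real \<Rightarrow> complex mat \<Rightarrow> bool" where
  "hs_bounded k K A \<longleftrightarrow> A \<in> carrier_mat k k \<and> (\<forall>X\<in>carrier_mat k k.
     hs_norm k (A * X) \<le> K * hs_norm k X \<and> hs_norm k (X * A) \<le> K * hs_norm k X)"

lemma hs_bounded_carrier: "hs_bounded k K A \<Longrightarrow> A \<in> carrier_mat k k"
  by (simp add: hs_bounded_def)

lemma hs_bounded_left: "hs_bounded k K A \<Longrightarrow> X \<in> carrier_mat k k \<Longrightarrow> hs_norm k (A * X) \<le> K * hs_norm k X"
  by (simp add: hs_bounded_def)

lemma hs_bounded_right: "hs_bounded k K A \<Longrightarrow> X \<in> carrier_mat k k \<Longrightarrow> hs_norm k (X * A) \<le> K * hs_norm k X"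
  by (simp add: hs_bounded_def)

lemma hs_bounded_const: "hs_bounded k (cmod c) (c \<cdot>\<^sub>m 1\<^sub>m k)"
proof -
  have "(c \<cdot>\<^sub>m 1\<^sub>m k) * X = c \<cdot>\<^sub>m X" "X * (c \<cdot>\<^sub>m 1\<^sub>m k) = c \<cdot>\<^sub>m X" if "X \<in> carrier_mat k k" for X
    using that mult_smult_assoc_mat[of "1\<^sub>m k" k k X k c] mult_smult_distrib[of X k k "1\<^sub>m k" k c] by auto
  then show ?thesis by (simp add: hs_bounded_def hs_norm_smult)
qed

lemma hs_bounded_add:
  assumes "hs_bounded k K A" "hs_bounded k L B"
  shows "hs_bounded k (K + L) (A + B)"
  unfolding hs_bounded_def
proof (intro conjI ballI)
  have c: "A \<in> carrier_mat k k" "B \<in> carrier_mat k k" using assms by (auto simp: hs_bounded_def)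
  then show "A + B \<in> carrier_mat k k" by simp
  fix X :: "complex mat" assume X: "X \<in> carrier_mat k k"
  have "hs_norm k ((A + B) * X) \<le> hs_norm k (A * X) + hs_norm k (B * X)"
    using c X by (simp add: add_mult_distrib_mat[of _ k k _ _ k] hs_norm_add)
  then show "hs_norm k ((A + B) * X) \<le> (K + L) * hs_norm k X"
    using hs_bounded_left[OF assms(1) X] hs_bounded_left[OF assms(2) X] by (simp add: distrib_right)
  have "hs_norm k (X * (A + B)) \<le> hs_norm k (X * A) + hs_norm k (X * B)"
    using c X by (simp add: mult_add_distrib_mat[of _ k k _ k] hs_norm_add)
  then show "hs_norm k (X * (A + B)) \<le> (K + L) * hs_norm k X"
    using hs_bounded_right[OF assms(1) X] hs_bounded_right[OF assms(2) X] by (simp add: distrib_right)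
qed

lemma hs_bounded_mult:
  assumes "hs_bounded k K A" "hs_bounded k L B" "0 \<le> K" "0 \<le> L"
  shows "hs_bounded k (K * L) (A * B)"
  unfolding hs_bounded_def
proof (intro conjI ballI)
  have c: "A \<in> carrier_mat k k" "B \<in> carrier_mat k k" using assms by (auto simp: hs_bounded_def)
  then show "A * B \<in> carrier_mat k k" by simp
  fix X :: "complex mat" assume X: "X \<in> carrier_mat k k"
  have "hs_norm k (A * (B * X)) \<le> K * hs_norm k (B * X)"
    using c X by (intro hs_bounded_left[OF assms(1)]) auto
  also have "\<dots> \<le> K * (L * hs_norm k X)"
    using assms X by (intro mult_left_mono hs_bounded_left) auto
  finally show "hs_norm k (A * B * X) \<le> K * L * hs_norm k X"
    using c X by (simp add: assoc_mult_mat[of _ k k _ k _ k])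
  have "hs_norm k ((X * A) * B) \<le> L * hs_norm k (X * A)"
    using c X by (intro hs_bounded_right[OF assms(2)]) auto
  also have "\<dots> \<le> L * (K * hs_norm k X)"
    using assms X by (intro mult_left_mono hs_bounded_right) auto
  finally show "hs_norm k (X * (A * B)) \<le> K * L * hs_norm k X"
    using c X by (simp add: assoc_mult_mat[of _ k k _ k _ k] mult.commute mult.left_commute)
qed

section \<open>Unitary conjugation\<close>

lemma unitary_mat_carrier: "unitary_mat k W \<Longrightarrow> W \<in> carrier_mat k k"
  by (simp add: unitary_mat_def)

lemma unitary_mat_right_inverse: "unitary_mat k W \<Longrightarrow> W * mat_adjoint W = 1\<^sub>m k"
  using mat_mult_left_right_inverse[of "mat_adjoint W" k W] mat_adjoint_carrier[of W k k]
  by (simp add: unitary_mat_def)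

lemma unitary_mat_adjoint: "unitary_mat k W \<Longrightarrow> unitary_mat k (mat_adjoint W)"
  using unitary_mat_right_inverse[of k W] mat_adjoint_carrier[of W k k] by (simp add: unitary_mat_def)

lemma mult_four_assoc:
  assumes "A \<in> carrier_mat k k" "B \<in> carrier_mat k k" "C \<in> carrier_mat k k" "D \<in> carrier_mat k k"
  shows "A * B * (C * D) = A * (B * C) * (D :: complex mat)"
  using assms by (simp add: assoc_mult_mat[of _ k k _ k _ k])

lemma unitary_mat_mult:
  assumes "unitary_mat k V" "unitary_mat k W"
  shows "unitary_mat k (V * W)"
proof -
  have c: "V \<in> carrier_mat k k" "W \<in> carrier_mat k k" using assms by (auto simp: unitary_mat_def)
  note c' = mat_adjoint_carrier[OF c(1)] mat_adjoint_carrier[OF c(2)]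
  have "mat_adjoint (V * W) * (V * W) = mat_adjoint W * (mat_adjoint V * V) * W"
    using c c' by (simp add: mat_adjoint_mult[of _ k k _ k] mult_four_assoc)
  then show ?thesis using assms c c' by (simp add: unitary_mat_def)
qed

lemma unitary_mat_one: "unitary_mat k (1\<^sub>m k)"
  by (simp add: unitary_mat_def)

lemma hs_norm_unitary_left:
  assumes "unitary_mat k W" "X \<in> carrier_mat k k"
  shows "hs_norm k (W * X) = hs_norm k X"
proof -
  have c: "W \<in> carrier_mat k k" using assms by (auto simp: unitary_mat_def)
  note c' = mat_adjoint_carrier[OF c] mat_adjoint_carrier[OF assms(2)]
  have "mat_adjoint (W * X) * (W * X) = mat_adjoint X * (mat_adjoint W * W) * X"
    using c c' assms(2) by (simp add: mat_adjoint_mult[of _ k k _ k] mult_four_assoc)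
  then show ?thesis using assms c c' by (simp add: unitary_mat_def hs_norm_def)
qed

lemma hs_norm_unitary_right:
  assumes "unitary_mat k W" "X \<in> carrier_mat k k"
  shows "hs_norm k (X * W) = hs_norm k X"
proof -
  have c: "W \<in> carrier_mat k k" using assms by (auto simp: unitary_mat_def)
  have "hs_norm k (X * W) = hs_norm k (mat_adjoint (X * W))"
    using c assms by (simp add: hs_norm_adjoint)
  also have "\<dots> = hs_norm k (mat_adjoint W * mat_adjoint X)"
    using c assms by (simp add: mat_adjoint_mult[of _ k k _ k])
  also have "\<dots> = hs_norm k X"
    using c assms by (simp add: hs_norm_unitary_left[OF unitary_mat_adjoint] mat_adjoint_carrier hs_norm_adjoint)
  finally show ?thesis .
qed

lemma hs_bounded_unitary: "unitary_mat k W \<Longrightarrow> hs_bounded k 1 W"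
  by (simp add: hs_bounded_def hs_norm_unitary_left hs_norm_unitary_right unitary_mat_carrier)

definition conj_mat :: "complex mat \<Rightarrow> complex mat \<Rightarrow> complex mat" where
  "conj_mat W B = W * B * mat_adjoint W"

lemma conj_mat_carrier:
  "W \<in> carrier_mat k k \<Longrightarrow> B \<in> carrier_mat k k \<Longrightarrow> conj_mat W B \<in> carrier_mat k k"
  using mat_adjoint_carrier[of W k k] by (simp add: conj_mat_def)

lemma conj_mat_minus:
  assumes "W \<in> carrier_mat k k" "A \<in> carrier_mat k k" "B \<in> carrier_mat k k"
  shows "conj_mat W (A - B) = conj_mat W A - conj_mat W B"
  using assms mat_adjoint_carrier[OF assms(1)]
  by (simp add: conj_mat_def mult_minus_distrib_mat[of _ k k _ k] minus_mult_distrib_mat[of _ k k _ _ k])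

lemma conj_mat_add:
  assumes "W \<in> carrier_mat k k" "A \<in> carrier_mat k k" "B \<in> carrier_mat k k"
  shows "conj_mat W (A + B) = conj_mat W A + conj_mat W B"
  using assms mat_adjoint_carrier[OF assms(1)]
  by (simp add: conj_mat_def mult_add_distrib_mat[of _ k k _ k] add_mult_distrib_mat[of _ k k _ _ k])

lemma conj_mat_mult:
  assumes "unitary_mat k W" "A \<in> carrier_mat k k" "B \<in> carrier_mat k k"
  shows "conj_mat W (A * B) = conj_mat W A * conj_mat W B"
proof -
  have c: "W \<in> carrier_mat k k" using assms by (simp add: unitary_mat_def)
  note c' = mat_adjoint_carrier[OF c]
  have "conj_mat W A * conj_mat W B = W * A * (mat_adjoint W * W) * B * mat_adjoint W"
    using c c' assms by (simp add: conj_mat_def assoc_mult_mat[of _ k k _ k _ k])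
  also have "\<dots> = conj_mat W (A * B)"
    using c c' assms by (simp add: unitary_mat_def conj_mat_def assoc_mult_mat[of _ k k _ k _ k])
  finally show ?thesis by simp
qed

lemma conj_mat_const:
  assumes "unitary_mat k W"
  shows "conj_mat W (c \<cdot>\<^sub>m 1\<^sub>m k) = c \<cdot>\<^sub>m 1\<^sub>m k"
proof -
  have c: "W \<in> carrier_mat k k" using assms by (simp add: unitary_mat_def)
  note c' = mat_adjoint_carrier[OF c]
  show ?thesis using c c' unitary_mat_right_inverse[OF assms]
    by (simp add: conj_mat_def mult_smult_distrib[of _ k k _ k] mult_smult_assoc_mat[of _ k k _ k])
qed

lemma conj_mat_conj_mat:
  assumes "V \<in> carrier_mat k k" "W \<in> carrier_mat k k" "A \<in> carrier_mat k k"
  shows "conj_mat V (conj_mat W A) = conj_mat (V * W) A"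
  using assms mat_adjoint_carrier[OF assms(1)] mat_adjoint_carrier[OF assms(2)]
  by (simp add: conj_mat_def mat_adjoint_mult[of _ k k _ k] assoc_mult_mat[of _ k k _ k _ k])

lemma hs_norm_conj_mat:
  assumes "unitary_mat k W" "A \<in> carrier_mat k k"
  shows "hs_norm k (conj_mat W A) = hs_norm k A"
  using assms unitary_mat_carrier[OF assms(1)]
  by (simp add: conj_mat_def hs_norm_unitary_left hs_norm_unitary_right unitary_mat_adjoint)

lemma hs_bounded_conj_mat:
  assumes "unitary_mat k W" "hs_bounded k K A" "0 \<le> K"
  shows "hs_bounded k K (conj_mat W A)"
  using hs_bounded_mult[OF hs_bounded_mult[OF hs_bounded_unitary[OF assms(1)] assms(2)]
      hs_bounded_unitary[OF unitary_mat_adjoint[OF assms(1)]]] assms(3)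
  by (simp add: conj_mat_def)

section \<open>Operator norm against Hilbert-Schmidt norm\<close>

lemma vec_norm2_eq_L2_set: "vec_norm2 v = L2_set (\<lambda>i. cmod (v $ i)) {..<dim_vec v}"
  by (simp add: vec_norm2_def L2_set_def)

lemma vec_norm2_smult: "vec_norm2 (c \<cdot>\<^sub>v v) = cmod c * vec_norm2 v"
proof -
  have "L2_set (\<lambda>i. cmod ((c \<cdot>\<^sub>v v) $ i)) {..<dim_vec v} = L2_set (\<lambda>i. cmod c * cmod (v $ i)) {..<dim_vec v}"
    by (intro L2_set_cong) (auto simp: norm_mult)
  then show ?thesis by (simp add: vec_norm2_eq_L2_set L2_set_right_distrib)
qed

text \<open>Needed before the real supremum in \<open>mat_opnorm\<close> can be used as an upper
  bound. Coordinates of a vector in the unit ball have modulus at most 1, so each coordinate of the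
  image is bounded by an absolute row sum.\<close>

lemma bdd_above_mat_opnorm:
  "bdd_above {vec_norm2 (A *\<^sub>v v) | v. dim_vec v = dim_col A \<and> vec_norm2 v \<le> 1}"
proof (rule bdd_aboveI)
  fix x assume "x \<in> {vec_norm2 (A *\<^sub>v v) | v. dim_vec v = dim_col A \<and> vec_norm2 v \<le> 1}"
  then obtain v where v: "x = vec_norm2 (A *\<^sub>v v)" "dim_vec v = dim_col A" "vec_norm2 v \<le> 1" by auto
  have v1: "cmod (v $ j) \<le> 1" if "j < dim_vec v" for j
    using member_le_L2_set[of "{..<dim_vec v}" j "\<lambda>i. cmod (v $ i)"] that v(3)
    by (simp add: vec_norm2_eq_L2_set)
  have "cmod ((A *\<^sub>v v) $ i) \<le> (\<Sum>j<dim_col A. cmod (A $$ (i, j)))" if "i < dim_row A" for i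
  proof -
    have "cmod ((A *\<^sub>v v) $ i) = cmod (\<Sum>j<dim_col A. A $$ (i, j) * v $ j)"
      using that v(2) by (simp add: scalar_prod_def atLeast0LessThan)
    also have "\<dots> \<le> (\<Sum>j<dim_col A. cmod (A $$ (i, j)))"
      using v1 v(2) by (intro sum_norm_le) (simp add: norm_mult mult_left_le)
    finally show ?thesis .
  qed
  then show "x \<le> L2_set (\<lambda>i. \<Sum>j<dim_col A. cmod (A $$ (i, j))) {..<dim_row A}"
    unfolding v(1) vec_norm2_eq_L2_set dim_mult_mat_vec by (intro L2_set_mono) auto
qed

lemma vec_norm2_mult_le:
  assumes "dim_vec v = dim_col A"
  shows "vec_norm2 (A *\<^sub>v v) \<le> mat_opnorm A * vec_norm2 v"
proof (cases "vec_norm2 v = 0")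
  case True
  then have "v $ i = 0" if "i < dim_vec v" for i
    using that by (simp add: vec_norm2_eq_L2_set L2_set_eq_0_iff)
  then have "(A *\<^sub>v v) $ i = 0" if "i < dim_row A" for i
    using that assms by (auto simp: scalar_prod_def intro!: sum.neutral)
  then have "vec_norm2 (A *\<^sub>v v) = 0" by (simp add: vec_norm2_eq_L2_set L2_set_eq_0_iff)
  with True show ?thesis by simp
next
  case False
  define c where "c = complex_of_real (1 / vec_norm2 v)"
  have pos: "vec_norm2 v > 0" using False by (simp add: vec_norm2_eq_L2_set less_le)
  have "vec_norm2 (c \<cdot>\<^sub>v v) \<le> 1" using pos by (simp add: vec_norm2_smult c_def norm_divide)
  then have "vec_norm2 (A *\<^sub>v (c \<cdot>\<^sub>v v)) \<le> mat_opnorm A"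
    unfolding mat_opnorm_def using assms by (intro cSup_upper bdd_above_mat_opnorm) auto
  also have "A *\<^sub>v (c \<cdot>\<^sub>v v) = c \<cdot>\<^sub>v (A *\<^sub>v v)"
    using assms by (intro mult_mat_vec[of _ "dim_row A" "dim_col A"]) (auto intro: carrier_vecI)
  finally show ?thesis using pos
    by (simp add: vec_norm2_smult c_def norm_divide divide_simps mult.commute)
qed

text \<open>The squared Hilbert-Schmidt norm is, up to the factor \<open>1/k\<close>, the sum of the
  squared norms of the columns, and \<open>A\<close> acts on \<open>X\<close> column by
  column.\<close>

lemma hs_norm_mult_le_opnorm:
  assumes "A \<in> carrier_mat k k" "X \<in> carrier_mat k k"
  shows "hs_norm k (A * X) \<le> mat_opnorm A * hs_norm k X"
proof -
  have fro: "L2_set (\<lambda>(i, j). cmod (Y $$ (i, j))) ({..<k} \<times> {..<k})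
      = L2_set (\<lambda>j. vec_norm2 (col Y j)) {..<k}" if "Y \<in> carrier_mat k k" for Y :: "complex mat"
  proof -
    have "(\<Sum>p\<in>{..<k} \<times> {..<k}. (case p of (i, j) \<Rightarrow> cmod (Y $$ (i, j)))\<^sup>2)
       = (\<Sum>i<k. \<Sum>j<k. (cmod (Y $$ (i, j)))\<^sup>2)"
      by (simp add: sum.cartesian_product split_def)
    also have "\<dots> = (\<Sum>j<k. \<Sum>i<k. (cmod (Y $$ (i, j)))\<^sup>2)" by (rule sum.swap)
    also have "\<dots> = (\<Sum>j<k. (vec_norm2 (col Y j))\<^sup>2)"
      using that by (intro sum.cong) (auto simp: vec_norm2_def sum_nonneg)
    finally show ?thesis by (simp add: L2_set_def)
  qed
  have nn: "mat_opnorm A \<ge> 0"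
  proof -
    have "vec_norm2 (A *\<^sub>v 0\<^sub>v k) \<le> mat_opnorm A"
      unfolding mat_opnorm_def using assms
      by (intro cSup_upper bdd_above_mat_opnorm) (auto simp: vec_norm2_def intro!: exI[of _ "0\<^sub>v k"])
    then show ?thesis by (rule order_trans[rotated]) (simp add: vec_norm2_eq_L2_set)
  qed
  have "L2_set (\<lambda>j. vec_norm2 (col (A * X) j)) {..<k}
      \<le> L2_set (\<lambda>j. mat_opnorm A * vec_norm2 (col X j)) {..<k}"
  proof (rule L2_set_mono)
    fix j assume "j \<in> {..<k}"
    then have "col (A * X) j = A *\<^sub>v col X j" using assms by (intro col_mult2[of _ k k _ k]) auto
    then show "vec_norm2 (col (A * X) j) \<le> mat_opnorm A * vec_norm2 (col X j)"
      using assms vec_norm2_mult_le[of "col X j" A] by simp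
  qed (simp add: vec_norm2_eq_L2_set)
  also have "\<dots> = mat_opnorm A * L2_set (\<lambda>j. vec_norm2 (col X j)) {..<k}"
    using nn by (simp add: L2_set_right_distrib)
  finally show ?thesis using assms
    by (simp add: hs_norm_eq_L2_set fro divide_right_mono)
qed

lemma hs_norm_le_opnorm:
  assumes "A \<in> carrier_mat k k" "k > 0"
  shows "hs_norm k A \<le> mat_opnorm A"
  using hs_norm_mult_le_opnorm[OF assms(1) one_carrier_mat] assms by (simp add: hs_norm_one)

lemma msa_carrier: "A \<in> msa k \<Longrightarrow> A \<in> carrier_mat k k"
  by (simp add: msa_def)

text \<open>Right multiplication reduces to left multiplication: taking adjoints preserves
  \<open>hs_norm\<close> and turns \<open>X * A\<close> into \<open>A * mat_adjoint X\<close> since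
  \<open>A\<close> is self-adjoint.\<close>

lemma hs_bounded_msa:
  assumes "A \<in> msa k" "mat_opnorm A \<le> R"
  shows "hs_bounded k R A"
proof -
  have A: "A \<in> carrier_mat k k" "mat_adjoint A = A" using assms by (auto simp: msa_def)
  have l: "hs_norm k (A * X) \<le> R * hs_norm k X" if "X \<in> carrier_mat k k" for X
    using hs_norm_mult_le_opnorm[OF A(1) that] mult_right_mono[OF assms(2) hs_norm_nonneg[OF that]] by simp
  have "hs_norm k (X * A) \<le> R * hs_norm k X" if X: "X \<in> carrier_mat k k" for X
  proof -
    have "hs_norm k (X * A) = hs_norm k (mat_adjoint (X * A))"
      using A X by (simp add: hs_norm_adjoint)
    also have "\<dots> = hs_norm k (A * mat_adjoint X)"
      using A X by (simp add: mat_adjoint_mult[of _ k k _ k])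
    also have "\<dots> \<le> R * hs_norm k X"
      using l[OF mat_adjoint_carrier[OF X]] by (simp add: hs_norm_adjoint X)
    finally show ?thesis .
  qed
  with l A show ?thesis by (simp add: hs_bounded_def)
qed

section \<open>Polynomials on matrix tuples: equivariance and dimension-free estimates\<close>

lemma nc_mat_conj_mat:
  assumes "unitary_mat k W" "nc_valid (length As) t" "set As \<subseteq> carrier_mat k k"
  shows "nc_mat k t (map (conj_mat W) As) = conj_mat W (nc_mat k t As)"
  using assms(2)
proof (induction t)
  case (Add s t)
  then show ?case using assms unitary_mat_carrier[OF assms(1)]
    by (simp add: conj_mat_add[of _ k] nc_mat_carrier)
next
  case (Mul s t)
  then show ?case using assms by (simp add: conj_mat_mult[of k] nc_mat_carrier)
qed (use assms in \<open>simp_all add: conj_mat_const\<close>)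

lemma nc_mat_star:
  assumes "nc_valid (length As) t" "set As \<subseteq> msa k"
  shows "nc_mat k (nc_star t) As = mat_adjoint (nc_mat k t As)"
  using assms(1)
proof (induction t)
  have As: "set As \<subseteq> carrier_mat k k" using assms(2) by (auto simp: msa_def)
  case (Add s t)
  then show ?case using As by (simp add: mat_adjoint_add[of _ k k] nc_mat_carrier)
next
  have As: "set As \<subseteq> carrier_mat k k" using assms(2) by (auto simp: msa_def)
  case (Mul s t)
  then show ?case using As by (simp add: mat_adjoint_mult[of _ k k _ k] nc_mat_carrier)
next
  case (Var i)
  then have "As ! i \<in> msa k" using assms(2) by auto
  then show ?case by (simp add: msa_def)
qed (simp add: mat_adjoint_smult)

text \<open>\<open>K\<close> is chosen before \<open>k\<close> and the tuple. This uniformity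
  supplies the factors in the product case of the Lipschitz estimate.\<close>

lemma nc_mat_hs_bounded:
  assumes "nc_valid n t" "R \<ge> 0"
  shows "\<exists>K\<ge>0. \<forall>k As. length As = n \<longrightarrow> (\<forall>A\<in>set As. hs_bounded k R A) \<longrightarrow> hs_bounded k K (nc_mat k t As)"
  using assms(1)
proof (induction t)
  case (Var i)
  then show ?case using assms(2) by (intro exI[of _ R]) auto
next
  case (Const c)
  show ?case by (intro exI[of _ "cmod c"]) (simp add: hs_bounded_const)
next
  case (Add s t)
  then obtain K L where "K \<ge> 0" "L \<ge> 0"
    "\<forall>k As. length As = n \<longrightarrow> (\<forall>A\<in>set As. hs_bounded k R A) \<longrightarrow> hs_bounded k K (nc_mat k s As)"
    "\<forall>k As. length As = n \<longrightarrow> (\<forall>A\<in>set As. hs_bounded k R A) \<longrightarrow> hs_bounded k L (nc_mat k t As)"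
    by auto
  then show ?case by (intro exI[of _ "K + L"]) (auto intro: hs_bounded_add)
next
  case (Mul s t)
  then obtain K L where "K \<ge> 0" "L \<ge> 0"
    "\<forall>k As. length As = n \<longrightarrow> (\<forall>A\<in>set As. hs_bounded k R A) \<longrightarrow> hs_bounded k K (nc_mat k s As)"
    "\<forall>k As. length As = n \<longrightarrow> (\<forall>A\<in>set As. hs_bounded k R A) \<longrightarrow> hs_bounded k L (nc_mat k t As)"
    by auto
  then show ?case by (intro exI[of _ "K * L"]) (auto intro: hs_bounded_mult)
qed

text \<open>Telescoping through \<open>A' * B\<close> leaves \<open>(A - A') * B\<close> and
  \<open>A' * (B - B')\<close>, so one right factor and one left factor need bounds.\<close>

lemma hs_norm_mult_diff:
  assumes "hs_bounded k K A'" "hs_bounded k L B" "A \<in> carrier_mat k k" "B' \<in> carrier_mat k k"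
  shows "hs_norm k (A * B - A' * B') \<le> L * hs_norm k (A - A') + K * hs_norm k (B - B')"
proof -
  have c: "A' \<in> carrier_mat k k" "B \<in> carrier_mat k k" using assms by (auto simp: hs_bounded_def)
  have "hs_norm k (A * B - A' * B') \<le> hs_norm k (A * B - A' * B) + hs_norm k (A' * B - A' * B')"
    using c assms by (intro hs_norm_triangle) auto
  also have "A * B - A' * B = (A - A') * B"
    using c assms by (simp add: minus_mult_distrib_mat[of _ k k _ _ k])
  also have "A' * B - A' * B' = A' * (B - B')"
    using c assms by (simp add: mult_minus_distrib_mat[of _ k k _ k])
  also have "hs_norm k ((A - A') * B) + hs_norm k (A' * (B - B'))
      \<le> L * hs_norm k (A - A') + K * hs_norm k (B - B')"
    using c assms by (intro add_mono hs_bounded_right[OF assms(2)] hs_bounded_left[OF assms(1)]) auto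
  finally show ?thesis .
qed

definition nc_lipschitz :: "nat \<Rightarrow> real \<Rightarrow> real \<Rightarrow> nc_term \<Rightarrow> bool" where
  "nc_lipschitz n R C t \<longleftrightarrow> (\<forall>k As As' d. length As = n \<longrightarrow> length As' = n \<longrightarrow>
      (\<forall>A\<in>set As \<union> set As'. hs_bounded k R A) \<longrightarrow> d \<ge> 0 \<longrightarrow>
      (\<forall>i<n. hs_norm k (As ! i - As' ! i) \<le> d) \<longrightarrow>
      hs_norm k (nc_mat k t As - nc_mat k t As') \<le> C * d)"

text \<open>The constant does not depend on the matrix size; this is what makes covering numbers of
  microstate spaces of different generators comparable.\<close>
lemma nc_lipschitz_exists:
  assumes "nc_valid n t" "R \<ge> 0"
  shows "\<exists>C\<ge>0. nc_lipschitz n R C t" (is "\<exists>C\<ge>0. ?L C t")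
  using assms(1)
proof (induction t)
  case (Var i)
  then show ?case by (intro exI[of _ 1]) (auto simp: nc_lipschitz_def)
next
  case (Const c)
  have "hs_norm k (c \<cdot>\<^sub>m 1\<^sub>m k - c \<cdot>\<^sub>m 1\<^sub>m k) = 0" for k
  proof -
    have "hs_norm k (0\<^sub>m k k) = 0"
      using hs_norm_smult[of "0\<^sub>m k k" k 0] by simp
    moreover have "c \<cdot>\<^sub>m 1\<^sub>m k - c \<cdot>\<^sub>m 1\<^sub>m k = 0\<^sub>m k k"
      by (rule minus_r_inv_mat) simp
    ultimately show ?thesis by (simp only:)
  qed
  then show ?case by (intro exI[of _ 0]) (auto simp: nc_lipschitz_def)
next
  case (Add s t)
  then obtain C D where C: "C \<ge> 0" "?L C s"
    and D: "D \<ge> 0" "?L D t"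
    by auto
  have "?L (C + D) (Add s t)"
    unfolding nc_lipschitz_def
  proof (intro allI impI)
    fix k As As' and d :: real
    assume a: "length As = n" "length As' = n" "\<forall>A\<in>set As \<union> set As'. hs_bounded k R A" "d \<ge> 0"
      "\<forall>i<n. hs_norm k (As ! i - As' ! i) \<le> d"
    have sub: "set As \<subseteq> carrier_mat k k" "set As' \<subseteq> carrier_mat k k"
      using a(3) by (auto dest: hs_bounded_carrier)
    have c: "nc_mat k s As \<in> carrier_mat k k" "nc_mat k t As \<in> carrier_mat k k"
      "nc_mat k s As' \<in> carrier_mat k k" "nc_mat k t As' \<in> carrier_mat k k"
      using Add.prems a(1,2) sub by (auto intro!: nc_mat_carrier)
    have "nc_mat k (Add s t) As - nc_mat k (Add s t) As'
        = (nc_mat k s As - nc_mat k s As') + (nc_mat k t As - nc_mat k t As')"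
      using c by (intro eq_matI) auto
    also have "hs_norm k \<dots> \<le> hs_norm k (nc_mat k s As - nc_mat k s As') + hs_norm k (nc_mat k t As - nc_mat k t As')"
      using c by (intro hs_norm_add) auto
    also have "\<dots> \<le> C * d + D * d" using C(2) D(2) a unfolding nc_lipschitz_def by (intro add_mono) blast+
    finally show "hs_norm k (nc_mat k (Add s t) As - nc_mat k (Add s t) As') \<le> (C + D) * d"
      by (simp add: distrib_right)
  qed
  with C D show ?case by (intro exI[of _ "C + D"]) auto
next
  case (Mul s t)
  then obtain C D where C: "C \<ge> 0" "?L C s"
    and D: "D \<ge> 0" "?L D t"
    by auto
  obtain K where K: "K \<ge> 0" "\<forall>k As. length As = n \<longrightarrow> (\<forall>A\<in>set As. hs_bounded k R A) \<longrightarrow> hs_bounded k K (nc_mat k s As)"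
    using nc_mat_hs_bounded[of n s R] Mul.prems assms(2) by auto
  obtain L where L: "L \<ge> 0" "\<forall>k As. length As = n \<longrightarrow> (\<forall>A\<in>set As. hs_bounded k R A) \<longrightarrow> hs_bounded k L (nc_mat k t As)"
    using nc_mat_hs_bounded[of n t R] Mul.prems assms(2) by auto
  \<comment> \<open>Product rule: \<open>K\<close> and \<open>L\<close> bound the values of
    \<open>s\<close> and \<open>t\<close>, while \<open>C\<close> and \<open>D\<close> are their
    Lipschitz constants.\<close>
  have "?L (L * C + K * D) (Mul s t)"
    unfolding nc_lipschitz_def
  proof (intro allI impI)
    fix k As As' and d :: real
    assume a: "length As = n" "length As' = n" "\<forall>A\<in>set As \<union> set As'. hs_bounded k R A" "d \<ge> 0"
      "\<forall>i<n. hs_norm k (As ! i - As' ! i) \<le> d"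
    have sub: "set As \<subseteq> carrier_mat k k" "set As' \<subseteq> carrier_mat k k"
      using a(3) by (auto dest: hs_bounded_carrier)
    have c: "nc_mat k s As \<in> carrier_mat k k" "nc_mat k t As' \<in> carrier_mat k k"
      using Mul.prems a(1,2) sub by (auto intro!: nc_mat_carrier)
    have "hs_norm k (nc_mat k (Mul s t) As - nc_mat k (Mul s t) As')
        \<le> L * hs_norm k (nc_mat k s As - nc_mat k s As') + K * hs_norm k (nc_mat k t As - nc_mat k t As')"
      using c K(2) L(2) a by (simp add: hs_norm_mult_diff)
    also have "\<dots> \<le> L * (C * d) + K * (D * d)"
      using C(2) D(2) a K(1) L(1) unfolding nc_lipschitz_def
      by (intro add_mono mult_left_mono) blast+
    finally show "hs_norm k (nc_mat k (Mul s t) As - nc_mat k (Mul s t) As') \<le> (L * C + K * D) * d"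
      by (simp add: distrib_right)
  qed
  with C D K L show ?case by (intro exI[of _ "L * C + K * D"]) auto
qed

lemma nc_lipschitz_mono: "nc_lipschitz n R C t \<Longrightarrow> C \<le> C' \<Longrightarrow> nc_lipschitz n R C' t"
  unfolding nc_lipschitz_def
  by (intro allI impI, rule order_trans[OF _ mult_right_mono[of C C']]) blast+

lemma hs_norm_le_of_hs_bounded:
  assumes "hs_bounded k R A" "k > 0"
  shows "hs_norm k A \<le> R"
  using hs_bounded_left[OF assms(1), of "1\<^sub>m k"] hs_bounded_carrier[OF assms(1)] assms(2)
  by (simp add: hs_norm_one)

text \<open>A crude factor depending on \<open>k\<close> is enough here, because the estimate only
  produces a finite cover at fixed \<open>k\<close>.\<close>

lemma hs_norm_le_entries:
  assumes "A \<in> carrier_mat k k" "k > 0" "\<And>i j. i < k \<Longrightarrow> j < k \<Longrightarrow> cmod (A $$ (i, j)) \<le> e"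
  shows "hs_norm k A \<le> (real k)\<^sup>2 * e"
proof -
  have e: "0 \<le> e" using assms(3)[of 0 0] assms(2) by (meson norm_ge_zero order_trans)
  have "L2_set (\<lambda>(i, j). cmod (A $$ (i, j))) ({..<k} \<times> {..<k})
      \<le> (\<Sum>(i, j)\<in>{..<k} \<times> {..<k}. cmod (A $$ (i, j)))"
    by (intro L2_set_le_sum) auto
  also have "\<dots> \<le> (\<Sum>(i, j)\<in>{..<k} \<times> {..<k}. e)"
    using assms(3) by (intro sum_mono) auto
  finally have "L2_set (\<lambda>(i, j). cmod (A $$ (i, j))) ({..<k} \<times> {..<k}) \<le> (real k)\<^sup>2 * e"
    by (simp add: split_def power2_eq_square)
  moreover have "x / sqrt (real k) \<le> x" if "0 \<le> x" for x
  proof -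
    have "x * 1 \<le> x * sqrt (real k)" using that assms(2) by (intro mult_left_mono) auto
    then show ?thesis using assms(2) by (simp add: divide_le_eq)
  qed
  ultimately show ?thesis
    unfolding hs_norm_eq_L2_set[OF assms(1)] using L2_set_nonneg order_trans by blast
qed

subsection \<open>Orbit covering numbers\<close>

lemma tuple_dist2_eq:
  assumes "\<And>i. i < length As \<Longrightarrow> As ! i \<in> carrier_mat k k \<and> Bs ! i \<in> carrier_mat k k"
  shows "tuple_dist2 k As Bs = L2_set (\<lambda>i. hs_norm k (As ! i - Bs ! i)) {..<length As}"
proof -
  have "(hs_norm k A)\<^sup>2 = Re (tau k (mat_adjoint A * A))" if "A \<in> carrier_mat k k" for A
    using hs_norm_nonneg[OF that] by (simp add: hs_norm_def)
  then show ?thesis using assms by (simp add: tuple_dist2_def L2_set_def)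
qed

lemma orbit_ballD:
  assumes "As \<in> orbit_ball k \<omega> Bs" "set Bs \<subseteq> carrier_mat k k"
  obtains W where "unitary_mat k W" "\<And>i. i < length Bs \<Longrightarrow> hs_norm k (As ! i - conj_mat W (Bs ! i)) < \<omega>"
proof -
  obtain W where W: "unitary_mat k W" "tuple_dist2 k As (map (conj_mat W) Bs) < \<omega>"
    using assms by (auto simp: orbit_ball_def conj_mat_def[abs_def])
  have len: "length As = length Bs" and c: "\<And>i. i < length As \<Longrightarrow> As ! i \<in> carrier_mat k k"
    using assms by (auto simp: orbit_ball_def)
  have d: "tuple_dist2 k As (map (conj_mat W) Bs)
      = L2_set (\<lambda>i. hs_norm k (As ! i - map (conj_mat W) Bs ! i)) {..<length As}"
    using c len assms(2) unitary_mat_carrier[OF W(1)]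
    by (intro tuple_dist2_eq) (auto intro!: conj_mat_carrier)
  have "hs_norm k (As ! i - conj_mat W (Bs ! i)) < \<omega>" if "i < length Bs" for i
    using member_le_L2_set[of "{..<length As}" i "\<lambda>i. hs_norm k (As ! i - map (conj_mat W) Bs ! i)"]
      that len W(2) d by simp
  then show ?thesis using that W by blast
qed

text \<open>Replacing the Euclidean sum over the tuple by the plain sum costs the factor
  \<open>length Bs\<close>, which does not depend on \<open>k\<close>. Together with
  \<open>orbit_ballD\<close> this allows all later estimates to be made coordinate by
  coordinate.\<close>

lemma orbit_ballI:
  assumes "length As = length Bs" "set As \<subseteq> carrier_mat k k" "set Bs \<subseteq> carrier_mat k k"
    "unitary_mat k W" "\<And>i. i < length Bs \<Longrightarrow> hs_norm k (As ! i - conj_mat W (Bs ! i)) \<le> d"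
    "real (length Bs) * d < \<omega>"
  shows "As \<in> orbit_ball k \<omega> Bs"
proof -
  have c: "\<And>i. i < length As \<Longrightarrow> As ! i \<in> carrier_mat k k \<and> map (conj_mat W) Bs ! i \<in> carrier_mat k k"
    using assms unitary_mat_carrier[OF assms(4)] by (auto intro!: conj_mat_carrier)
  then have "tuple_dist2 k As (map (conj_mat W) Bs)
      = L2_set (\<lambda>i. hs_norm k (As ! i - map (conj_mat W) Bs ! i)) {..<length As}"
    by (rule tuple_dist2_eq)
  also have "\<dots> \<le> (\<Sum>i<length As. hs_norm k (As ! i - map (conj_mat W) Bs ! i))"
    using c by (intro L2_set_le_sum) (auto intro!: hs_norm_nonneg)
  also have "\<dots> \<le> (\<Sum>i<length As. d)"
    using assms by (intro sum_mono) auto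
  also have "\<dots> < \<omega>" using assms by simp
  finally show ?thesis using assms c
    by (auto simp: orbit_ball_def conj_mat_def[abs_def] intro!: exI[of _ W])
qed

text \<open>Without a finite cover the infimum in the covering number would be the junk value 0,
  so total boundedness of the microstate spaces is needed to compare covering numbers.\<close>
lemma finite_orbit_cover_exists:
  assumes \<Sigma>: "\<And>As. As \<in> \<Sigma> \<Longrightarrow> length As = n \<and> (\<forall>A\<in>set As. hs_bounded k R A)"
    and "k > 0" "\<omega> > 0"
  obtains F where "finite F" "F \<subseteq> \<Sigma>" "\<Sigma> \<subseteq> (\<Union>B\<in>F. orbit_ball k \<omega> B)"
proof -
  \<comment> \<open>Entries within \<open>2 * e\<close> have to force a common orbit ball:
    \<open>hs_norm_le_entries\<close> costs \<open>(real k)\<^sup>2\<close> and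
    \<open>orbit_ballI\<close> costs \<open>n\<close>. The summand 1 keeps \<open>D\<close> positive
    for \<open>n = 0\<close> and makes \<open>e2\<close> strict.\<close>
  define D where "D = real n * (real k)\<^sup>2 + 1"
  define e where "e = \<omega> / (2 * D)"
  have den: "0 < D" by (simp add: D_def add_nonneg_pos)
  have e: "e > 0" using den assms(3) by (simp add: e_def)
  have "2 * e * D = \<omega>"
    using den by (simp add: e_def)
  then have e2: "real n * ((real k)\<^sup>2 * (2 * e)) < \<omega>"
    using e by (simp add: D_def algebra_simps)
  have "\<forall>e>0. \<exists>G. finite G \<and> cball (0::complex) (sqrt (real k) * R) \<subseteq> (\<Union>g\<in>G. ball g e)"
    using compact_cball[of "0::complex" "sqrt (real k) * R"]
    unfolding compact_eq_totally_bounded by (rule conjunct2)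
  then obtain G where G: "finite G" "cball (0::complex) (sqrt (real k) * R) \<subseteq> (\<Union>g\<in>G. ball g e)"
    using e by blast
  define pick where "pick z = (SOME g. g \<in> G \<and> dist g z < e)" for z
  have pick: "pick z \<in> G \<and> dist (pick z) z < e" if "cmod z \<le> sqrt (real k) * R" for z
  proof -
    have "z \<in> cball 0 (sqrt (real k) * R)" using that by simp
    with G(2) have "z \<in> (\<Union>g\<in>G. ball g e)" by (rule subsetD)
    then have "\<exists>g. g \<in> G \<and> dist g z < e" by auto
    then show ?thesis unfolding pick_def by (rule someI_ex)
  qed
  define I where "I = {..<n} \<times> {..<k} \<times> {..<k}"
  \<comment> \<open>\<open>f\<close> rounds every entry to the finite net \<open>G\<close>, so it
    takes finitely many values. Tuples with equal roundings are entrywise within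
    \<open>2 * e\<close>, hence in each other's orbit balls already with the identity as
    unitary.\<close>
  define f where "f As = restrict (\<lambda>(i, a, b). pick (As ! i $$ (a, b))) I" for As :: "complex mat list"
  have entry: "cmod (As ! i $$ (a, b)) \<le> sqrt (real k) * R"
    if "As \<in> \<Sigma>" "i < n" "a < k" "b < k" for As i a b
  proof -
    have h: "hs_bounded k R (As ! i)" using \<Sigma>[OF that(1)] that(2) by auto
    have "cmod (As ! i $$ (a, b)) \<le> sqrt (real k) * hs_norm k (As ! i)"
      using cmod_entry_le_hs_norm[OF hs_bounded_carrier[OF h]] that by blast
    also have "\<dots> \<le> sqrt (real k) * R"
      using hs_norm_le_of_hs_bounded[OF h assms(2)] by (intro mult_left_mono) auto
    finally show ?thesis .
  qed
  have "f ` \<Sigma> \<subseteq> (\<Pi>\<^sub>E p\<in>I. G)"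
  proof (rule image_subsetI)
    fix As assume As: "As \<in> \<Sigma>"
    have "(case p of (i, a, b) \<Rightarrow> pick (As ! i $$ (a, b))) \<in> G" if "p \<in> I" for p
      using pick[OF entry[OF As]] that by (cases p) (simp add: I_def)
    then show "f As \<in> (\<Pi>\<^sub>E p\<in>I. G)" unfolding f_def restrict_PiE_iff by blast
  qed
  then have fin: "finite (f ` \<Sigma>)"
    by (rule finite_subset) (intro finite_PiE, simp_all add: I_def G(1))
  have close: "As \<in> orbit_ball k \<omega> Bs" if "As \<in> \<Sigma>" "Bs \<in> \<Sigma>" "f As = f Bs" for As Bs
  proof (rule orbit_ballI)
    show "length As = length Bs" using \<Sigma>[OF that(1)] \<Sigma>[OF that(2)] by simp
    show cs: "set As \<subseteq> carrier_mat k k" "set Bs \<subseteq> carrier_mat k k"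
      using \<Sigma>[OF that(1)] \<Sigma>[OF that(2)] by (auto dest: hs_bounded_carrier)
    show "unitary_mat k (1\<^sub>m k)" by (rule unitary_mat_one)
    show "real (length Bs) * ((real k)\<^sup>2 * (2 * e)) < \<omega>" using e2 \<Sigma>[OF that(2)] by simp
    fix i assume i: "i < length Bs"
    then have i': "i < n" using \<Sigma>[OF that(2)] by simp
    have c: "As ! i \<in> carrier_mat k k" "Bs ! i \<in> carrier_mat k k"
      using cs i i' \<Sigma>[OF that(1)] \<Sigma>[OF that(2)] nth_mem by blast+
    have "cmod ((As ! i - Bs ! i) $$ (a, b)) \<le> 2 * e" if ab: "a < k" "b < k" for a b
    proof -
      have "f As (i, a, b) = f Bs (i, a, b)" using \<open>f As = f Bs\<close> by simp
      then have "pick (As ! i $$ (a, b)) = pick (Bs ! i $$ (a, b))"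
        using i' ab by (simp add: f_def I_def)
      moreover have "dist (pick (As ! i $$ (a, b))) (As ! i $$ (a, b)) < e"
        "dist (pick (Bs ! i $$ (a, b))) (Bs ! i $$ (a, b)) < e"
        using pick entry i' ab \<open>As \<in> \<Sigma>\<close> \<open>Bs \<in> \<Sigma>\<close> by blast+
      ultimately have "dist (As ! i $$ (a, b)) (Bs ! i $$ (a, b)) \<le> 2 * e"
        using dist_triangle3[of "As ! i $$ (a, b)" "Bs ! i $$ (a, b)" "pick (Bs ! i $$ (a, b))"] by simp
      then show ?thesis using c ab by (simp add: dist_norm)
    qed
    then have "hs_norm k (As ! i - Bs ! i) \<le> (real k)\<^sup>2 * (2 * e)"
      using c assms(2) by (intro hs_norm_le_entries) auto
    then show "hs_norm k (As ! i - conj_mat (1\<^sub>m k) (Bs ! i)) \<le> (real k)\<^sup>2 * (2 * e)"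
      using c by (simp add: conj_mat_def)
  qed
  \<comment> \<open>The centres must lie in \<open>\<Sigma>\<close>, so one member of each fibre of
    \<open>f\<close> is taken instead of the rounded tuple.\<close>
  define h where "h c = (SOME As. As \<in> \<Sigma> \<and> f As = c)" for c
  have h: "h (f As) \<in> \<Sigma> \<and> f (h (f As)) = f As" if "As \<in> \<Sigma>" for As
    unfolding h_def by (rule someI[of _ As]) (use that in simp)
  show ?thesis
  proof
    show "finite (h ` f ` \<Sigma>)" using fin by simp
    show "h ` f ` \<Sigma> \<subseteq> \<Sigma>" using h by auto
    show "\<Sigma> \<subseteq> (\<Union>B\<in>h ` f ` \<Sigma>. orbit_ball k \<omega> B)"
    proof
      fix As assume "As \<in> \<Sigma>"
      then have "As \<in> orbit_ball k \<omega> (h (f As))" using h[of As] by (intro close) auto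
      then show "As \<in> (\<Union>B\<in>h ` f ` \<Sigma>. orbit_ball k \<omega> B)" using \<open>As \<in> \<Sigma>\<close> by blast
    qed
  qed
qed

text \<open>Each ball of an optimal cover of \<open>\<Sigma>'\<close> is replaced by one around a
  point of \<open>\<Sigma>\<close> that \<open>g\<close> sends into it; by \<open>close\<close> it
  contains every other such point. The cover \<open>F\<close> only ensures that the infimum for
  \<open>\<Sigma>'\<close> is attained.\<close>

lemma orbit_cover_num_pullback:
  assumes F: "finite F" "F \<subseteq> \<Sigma>'" "\<Sigma>' \<subseteq> (\<Union>B\<in>F. orbit_ball k \<omega>' B)"
    and g: "g ` \<Sigma> \<subseteq> \<Sigma>'"
    and close: "\<And>B B' C. B \<in> \<Sigma> \<Longrightarrow> B' \<in> \<Sigma> \<Longrightarrow> C \<in> \<Sigma>' \<Longrightarrow>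
      g B \<in> orbit_ball k \<omega>' C \<Longrightarrow> g B' \<in> orbit_ball k \<omega>' C \<Longrightarrow> B \<in> orbit_ball k \<omega> B'"
  shows "orbit_cover_num k \<Sigma> \<omega> \<le> orbit_cover_num k \<Sigma>' \<omega>'"
proof -
  let ?S = "\<lambda>\<Sigma> \<omega>. {card F | F. finite F \<and> F \<subseteq> \<Sigma> \<and> \<Sigma> \<subseteq> (\<Union>B\<in>F. orbit_ball k \<omega> B)}"
  have "?S \<Sigma>' \<omega>' \<noteq> {}" using F by blast
  then have "orbit_cover_num k \<Sigma>' \<omega>' \<in> ?S \<Sigma>' \<omega>'"
    unfolding orbit_cover_num_def by (rule Inf_nat_def1)
  then obtain E where E: "orbit_cover_num k \<Sigma>' \<omega>' = card E" "finite E" "E \<subseteq> \<Sigma>'"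
    "\<Sigma>' \<subseteq> (\<Union>B\<in>E. orbit_ball k \<omega>' B)"
    by auto
  define h where "h C = (SOME B. B \<in> \<Sigma> \<and> g B \<in> orbit_ball k \<omega>' C)" for C
  \<comment> \<open>Balls that miss the image of \<open>g\<close> have no preimage to serve as a new
    centre and are dropped.\<close>
  define E0 where "E0 = {C \<in> E. \<exists>B\<in>\<Sigma>. g B \<in> orbit_ball k \<omega>' C}"
  have h: "h C \<in> \<Sigma> \<and> g (h C) \<in> orbit_ball k \<omega>' C" if "C \<in> E0" for C
    unfolding h_def by (rule someI_ex) (use that in \<open>auto simp: E0_def\<close>)
  have "\<Sigma> \<subseteq> (\<Union>B\<in>h ` E0. orbit_ball k \<omega> B)"
  proof
    fix B assume B: "B \<in> \<Sigma>"
    then obtain C where C: "C \<in> E" "g B \<in> orbit_ball k \<omega>' C" using g E(4) by blast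
    then have "C \<in> E0" using B by (auto simp: E0_def)
    then have "B \<in> orbit_ball k \<omega> (h C)" using h[of C] B C E(3) by (intro close[of _ _ C]) auto
    with \<open>C \<in> E0\<close> show "B \<in> (\<Union>B\<in>h ` E0. orbit_ball k \<omega> B)" by blast
  qed
  moreover have "finite E0" using E(2) by (simp add: E0_def)
  moreover have "h ` E0 \<subseteq> \<Sigma>" using h by auto
  ultimately have "card (h ` E0) \<in> ?S \<Sigma> \<omega>" by blast
  then have "orbit_cover_num k \<Sigma> \<omega> \<le> card (h ` E0)"
    unfolding orbit_cover_num_def by (rule wellorder_Inf_le1)
  also have "\<dots> \<le> card E0" using \<open>finite E0\<close> by (rule card_image_le)
  also have "\<dots> \<le> card E" using E(2) by (intro card_mono) (auto simp: E0_def)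
  finally show ?thesis using E(1) by simp
qed

subsection \<open>Density of polynomials in generators\<close>

lemma cstar_diff: "cstar (x - y) = cstar x - cstar (y :: 'a::cstar_algebra)"
  using cstar_add[of "x - y" y] by simp

lemma cstar_one: "cstar 1 = (1 :: 'a::cstar_algebra)"
  using cstar_mult[of 1 "cstar (1::'a)"] by (simp add: cstar_cstar)

lemma norm_cstar: "norm (cstar x) = norm (x :: 'a::cstar_algebra)"
proof -
  have le: "norm x \<le> norm (cstar x)" for x :: 'a
  proof (cases "x = 0")
    case False
    have "norm x * norm x = norm (cstar x * x)" by (simp add: cstar_identity power2_eq_square)
    also have "\<dots> \<le> norm (cstar x) * norm x" by (rule norm_mult_ineq)
    finally show ?thesis using False by simp
  qed simp
  show ?thesis using le[of x] le[of "cstar x"] by (simp add: cstar_cstar)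
qed

lemma scaleC_diff_right: "scaleC c (x - y) = scaleC c x - scaleC c (y :: 'a::cstar_algebra)"
  using scaleC_add_right[of c "x - y" y] by simp

lemma scaleC_diff_left: "scaleC (c - d) x = scaleC c x - scaleC d (x :: 'a::cstar_algebra)"
  using scaleC_add_left[of "c - d" d x] by simp

lemma nc_eval_star:
  assumes "nc_valid (length zs) t" "\<forall>z\<in>set zs. cstar z = z"
  shows "nc_eval (nc_star t) zs = cstar (nc_eval t zs)"
  using assms by (induction t) (auto simp: cstar_scaleC cstar_one cstar_add cstar_mult)

text \<open>Separate continuity suffices: first \<open>a\<close> is moved to the closure with
  \<open>b\<close> in \<open>B\<close>, then \<open>b\<close> with \<open>a\<close> already a
  limit.\<close>

lemma closure_binop:
  fixes f :: "'a::topological_space \<Rightarrow> 'b::topological_space \<Rightarrow> 'c::topological_space"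
  assumes "\<And>a. continuous_on UNIV (f a)" "\<And>b. continuous_on UNIV (\<lambda>a. f a b)"
    and AB: "\<And>a b. a \<in> A \<Longrightarrow> b \<in> B \<Longrightarrow> f a b \<in> closure C"
    and "a \<in> closure A" "b \<in> closure B"
  shows "f a b \<in> closure C"
proof -
  have 1: "f a b \<in> closure C" if "b \<in> B" for b
  proof -
    have "(\<lambda>a. f a b) ` closure A \<subseteq> closure C"
      using that AB by (intro image_closure_subset continuous_on_subset[OF assms(2)]) auto
    with assms(4) show ?thesis by blast
  qed
  have "f a ` closure B \<subseteq> closure C"
    using 1 by (intro image_closure_subset continuous_on_subset[OF assms(1)]) auto
  with assms(5) show ?thesis by blast
qed

lemma closure_complex_rats: "closure complex_rats = UNIV"
proof -
  have "\<exists>y\<in>complex_rats. dist y z < e" if "e > 0" for z e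
  proof -
    obtain p q where pq: "p \<in> \<rat>" "Re z < p" "p < Re z + e / 2" "q \<in> \<rat>" "Im z < q" "q < Im z + e / 2"
      using Rats_dense_in_real[of "Re z" "Re z + e / 2"] Rats_dense_in_real[of "Im z" "Im z + e / 2"] \<open>e > 0\<close>
      by auto
    have "cmod (Complex p q - z) \<le> \<bar>Re (Complex p q - z)\<bar> + \<bar>Im (Complex p q - z)\<bar>" by (rule cmod_le)
    also have "\<dots> < e" using pq by simp
    finally show ?thesis using pq by (intro bexI[of _ "Complex p q"]) (auto simp: dist_norm complex_rats_def)
  qed
  then show ?thesis by (auto simp: closure_approachable)
qed

text \<open>Values of terms admit only complex rational scalars, so they need not form a complex
  subspace. The induction over the generated star-subalgebra therefore targets the closure of
  \<open>D\<close>, where arbitrary scalars arise as limits.\<close>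

lemma nc_eval_dense:
  fixes zs :: "'a::cstar_algebra list"
  assumes sa: "\<forall>z\<in>set zs. cstar z = z" and gen: "generates_cstar (set zs)" and e: "e > 0"
  obtains t where "nc_valid (length zs) t" "norm (nc_eval t zs - a) < e"
proof -
  define D where "D = {nc_eval t zs | t. nc_valid (length zs) t}"
  have D: "nc_eval t zs \<in> D" if "nc_valid (length zs) t" for t using that by (auto simp: D_def)
  have D_add: "x + y \<in> D" if xy: "x \<in> D" "y \<in> D" for x y
  proof -
    from xy obtain s t where "nc_valid (length zs) s" "x = nc_eval s zs" "nc_valid (length zs) t" "y = nc_eval t zs"
      by (auto simp: D_def)
    then show ?thesis using D[of "Add s t"] by simp
  qed
  have D_mult: "x * y \<in> D" if xy: "x \<in> D" "y \<in> D" for x y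
  proof -
    from xy obtain s t where "nc_valid (length zs) s" "x = nc_eval s zs" "nc_valid (length zs) t" "y = nc_eval t zs"
      by (auto simp: D_def)
    then show ?thesis using D[of "Mul s t"] by simp
  qed
  have D_scale: "scaleC c x \<in> D" if xy: "x \<in> D" "c \<in> complex_rats" for x c
  proof -
    from xy obtain s where "nc_valid (length zs) s" "x = nc_eval s zs" by (auto simp: D_def)
    then show ?thesis using D[of "Mul (Const c) s"] that by (simp add: mult_scaleC_left)
  qed
  have D_star: "cstar x \<in> D" if xy: "x \<in> D" for x
  proof -
    from xy obtain s where "nc_valid (length zs) s" "x = nc_eval s zs" by (auto simp: D_def)
    then show ?thesis using D[of "nc_star s"] sa by (simp add: nc_eval_star nc_valid_star)
  qed
  have cont_right: "continuous_on UNIV (\<lambda>x. scaleC c (x::'a))" for c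
    by (rule lipschitz_on_continuous_on[of "cmod c"])
      (auto intro!: lipschitz_onI simp: dist_norm norm_scaleC simp flip: scaleC_diff_right)
  have cont_left: "continuous_on UNIV (\<lambda>c. scaleC c (x::'a))" for x
    by (rule lipschitz_on_continuous_on[of "norm x"])
      (auto intro!: lipschitz_onI simp: dist_norm norm_scaleC mult.commute simp flip: scaleC_diff_left)
  have cont_star: "continuous_on UNIV (cstar :: 'a \<Rightarrow> 'a)"
    by (rule lipschitz_on_continuous_on[of 1])
      (auto intro!: lipschitz_onI simp: dist_norm norm_cstar simp flip: cstar_diff)
  have sub: "x \<in> closure D" if "x \<in> D" for x using that closure_subset by blast
  have "star_subalg_gen (set zs) \<subseteq> closure D"
  proof
    fix x assume "x \<in> star_subalg_gen (set zs)"
    then show "x \<in> closure D"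
    proof induction
      case (gen x)
      then obtain i where "i < length zs" "x = zs ! i" by (auto simp: in_set_conv_nth)
      then have "x \<in> D" using D[of "Var i"] by simp
      then show ?case by (rule sub)
    next
      case one
      have "1 \<in> D" using D[of "Const 1"] by (simp add: complex_rats_closed scaleC_one)
      then show ?case by (rule sub)
    next
      case (add x y)
      show ?case
        by (rule closure_binop[of "(+)" D D D, OF _ _ _ add.IH])
          (rule continuous_on_add continuous_on_const continuous_on_id sub D_add | assumption)+
    next
      case (mult x y)
      show ?case
        by (rule closure_binop[of "(*)" D D D, OF _ _ _ mult.IH])
          (rule continuous_on_mult continuous_on_const continuous_on_id sub D_mult | assumption)+
    next
      case (scale x c)
      have "c \<in> closure complex_rats" by (simp add: closure_complex_rats)
      from closure_binop[of scaleC complex_rats D D, OF cont_right cont_left _ this scale.IH]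
      show ?case by (simp add: sub D_scale)
    next
      case (star x)
      have "cstar ` closure D \<subseteq> closure D"
        by (intro image_closure_subset continuous_on_subset[OF cont_star]) (use sub D_star in blast)+
      with star show ?case by blast
    qed
  qed
  then have "closure (star_subalg_gen (set zs)) \<subseteq> closure D" by (simp add: closure_minimal)
  then have "a \<in> closure D" using gen by (auto simp: generates_cstar_def)
  then obtain y where "y \<in> D" "dist y a < e" using e by (auto simp: closure_approachable)
  then show ?thesis using that by (auto simp: D_def dist_norm)
qed

text \<open>Semantic rather than syntactic: the symmetrisation \<open>(s + nc_star s) / 2\<close> is
  not literally fixed by \<open>nc_star\<close>, but its values on self-adjoint matrices are
  self-adjoint.\<close>

definition nc_selfadjoint :: "nat \<Rightarrow> nc_term \<Rightarrow> bool" where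
  "nc_selfadjoint N t \<longleftrightarrow> nc_valid N t \<and>
     (\<forall>k As. length As = N \<longrightarrow> set As \<subseteq> msa k \<longrightarrow> nc_mat k t As \<in> msa k)"

text \<open>Symmetrising an approximation does not increase the error: as \<open>a\<close> is
  self-adjoint, the new error is the self-adjoint part of the old one, and \<open>cstar\<close> is
  isometric.\<close>

lemma nc_eval_dense_selfadjoint:
  fixes zs :: "'a::cstar_algebra list"
  assumes sa: "\<forall>z\<in>set zs. cstar z = z" and gen: "generates_cstar (set zs)" and e: "e > 0"
    and a: "cstar a = a"
  obtains t where "nc_selfadjoint (length zs) t" "norm (nc_eval t zs - a) < e"
proof -
  obtain s where s: "nc_valid (length zs) s" "norm (nc_eval s zs - a) < e"
    using nc_eval_dense[OF sa gen e] by blast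
  define t where "t = Mul (Const (1/2)) (Add s (nc_star s))"
  have v: "nc_valid (length zs) t"
    using s(1) complex_rats_closed(3) by (simp add: t_def nc_valid_star)
  have "nc_mat k t As \<in> msa k" if As: "length As = length zs" "set As \<subseteq> msa k" for k As
  proof -
    have c: "nc_mat k s As \<in> carrier_mat k k"
      using As s(1) by (intro nc_mat_carrier) (auto dest: msa_carrier)
    then have c': "mat_adjoint (nc_mat k s As) \<in> carrier_mat k k" by (rule mat_adjoint_carrier)
    have eq: "nc_mat k t As = (1/2) \<cdot>\<^sub>m (nc_mat k s As + mat_adjoint (nc_mat k s As))"
      using c c' As s(1) by (simp add: t_def nc_mat_star mult_smult_assoc_mat[of _ k k _ k])
    show ?thesis using c c' unfolding eq
      by (simp add: msa_def mat_adjoint_smult mat_adjoint_add[of _ k k] comm_add_mat[of _ k k])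
  qed
  then have 1: "nc_selfadjoint (length zs) t" using v by (simp add: nc_selfadjoint_def)
  let ?d = "nc_eval s zs - a"
  have half: "scaleC (1/2) (a + a) = a"
  proof -
    have "scaleC (complex_of_real (1/2)) (a + a) = a"
      unfolding scaleC_of_real by (rule scaleR_half_double)
    then show ?thesis by simp
  qed
  have "scaleC (1/2) (?d + cstar ?d) = scaleC (1/2) (nc_eval s zs + cstar (nc_eval s zs) - (a + a))"
    by (simp add: cstar_diff a algebra_simps)
  also have "\<dots> = nc_eval t zs - a"
    using s(1) sa half by (simp add: t_def nc_eval_star mult_scaleC_left scaleC_diff_right)
  finally have "norm (nc_eval t zs - a) = norm (scaleC (1/2) (?d + cstar ?d))" by simp
  also have "\<dots> = 1/2 * norm (?d + cstar ?d)" unfolding norm_scaleC by simp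
  also have "\<dots> \<le> 1/2 * (norm ?d + norm (cstar ?d))" by (intro mult_left_mono norm_triangle_ineq) simp
  also have "\<dots> < e" using s(2) by (simp add: norm_cstar)
  finally show ?thesis using 1 that by blast
qed

subsection \<open>Comparison of microstate spaces\<close>

lemma tendsto_nc_eval:
  fixes zs :: "nat \<Rightarrow> 'a::cstar_algebra list"
  assumes "nc_valid n t" "\<And>i. i < n \<Longrightarrow> (\<lambda>m. zs m ! i) \<longlonglongrightarrow> xs ! i"
  shows "(\<lambda>m. nc_eval t (zs m)) \<longlonglongrightarrow> nc_eval t xs"
  using assms(1) by (induction t) (auto intro!: tendsto_intros assms(2))

lemma Gamma_top_Nil:
  "As \<in> Gamma_top xs [] R k \<epsilon> r \<longleftrightarrow> length As = length xs \<and> set As \<subseteq> msa k \<and>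
     (\<forall>M\<in>set As. mat_opnorm M \<le> R) \<and>
     (\<forall>j\<in>{1..r}. \<bar>mat_opnorm (eval_mat k (Ppoly (length xs) j) As)
        - norm (eval_alg (Ppoly (length xs) j) xs)\<bar> \<le> \<epsilon>)"
  by (auto simp: Gamma_top_def)

text \<open>Finitely many terms occur among the first \<open>r\<close> enumerated polynomials. This
  \<open>r\<close> depends on \<open>T\<close> alone, so it works for all matrix sizes, cut-offs and
  tolerances.\<close>

lemma Gamma_top_term_bound:
  fixes ys :: "'a::cstar_algebra list"
  assumes "finite T" "\<And>t. t \<in> T \<Longrightarrow> nc_valid (length ys) t"
  obtains r where "r \<ge> 1" "\<And>R k \<epsilon> Bs t. Bs \<in> Gamma_top ys [] R k \<epsilon> r \<Longrightarrow> t \<in> T \<Longrightarrow>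
      \<bar>mat_opnorm (nc_mat k t Bs) - norm (nc_eval t ys)\<bar> \<le> \<epsilon>"
proof -
  have "\<exists>j. j \<ge> 1 \<and> Ppoly (length ys) j = coeff_fun (nc_monoms t)" if "t \<in> T" for t
    using term_Ppoly[OF assms(2)[OF that]] by metis
  then obtain J where J: "\<And>t. t \<in> T \<Longrightarrow> J t \<ge> 1 \<and> Ppoly (length ys) (J t) = coeff_fun (nc_monoms t)"
    by metis
  define r where "r = Max (insert 1 (J ` T))"
  have r: "r \<ge> 1" "\<And>t. t \<in> T \<Longrightarrow> J t \<le> r" using assms(1) by (auto simp: r_def)
  have "\<bar>mat_opnorm (nc_mat k t Bs) - norm (nc_eval t ys)\<bar> \<le> \<epsilon>"
    if B: "Bs \<in> Gamma_top ys [] R k \<epsilon> r" and t: "t \<in> T" for R k \<epsilon> Bs t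
  proof -
    have l: "length Bs = length ys" "set Bs \<subseteq> carrier_mat k k"
      using B by (auto simp: Gamma_top_Nil dest: msa_carrier)
    have "\<forall>j\<in>{1..r}. \<bar>mat_opnorm (eval_mat k (Ppoly (length ys) j) Bs)
        - norm (eval_alg (Ppoly (length ys) j) ys)\<bar> \<le> \<epsilon>"
      using B by (simp add: Gamma_top_Nil)
    moreover have "J t \<in> {1..r}" using J[OF t] r(2)[OF t] by simp
    ultimately have "\<bar>mat_opnorm (eval_mat k (Ppoly (length ys) (J t)) Bs)
        - norm (eval_alg (Ppoly (length ys) (J t)) ys)\<bar> \<le> \<epsilon>"
      by (rule bspec)
    then show ?thesis using J[OF t] assms(2)[OF t] l
      by (simp add: eval_alg_coeff_fun eval_mat_coeff_fun)
  qed
  with r(1) that show ?thesis by blast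
qed

lemma nc_mat_minus_Var:
  assumes "X \<in> carrier_mat k k" "B \<in> carrier_mat k k"
  shows "X + (- 1) \<cdot>\<^sub>m 1\<^sub>m k * B = X - (B :: complex mat)"
proof -
  have "(- 1) \<cdot>\<^sub>m 1\<^sub>m k * B = (- 1) \<cdot>\<^sub>m B"
    using assms mult_smult_assoc_mat[of "1\<^sub>m k" k k B k "-1"] by simp
  then show ?thesis using assms by (intro eq_matI) auto
qed

text \<open>The radius \<open>\<omega>\<^sub>0\<close> only involves the Lipschitz constant of \<open>Q\<close>, so it may be fixed before
  \<open>\<epsilon>'\<close> and \<open>r'\<close>, on which \<open>S\<close> depends.\<close>
lemma orbit_cover_num_Gamma_top_le:
  fixes xs ys :: "'a::cstar_algebra list"
  assumes sax: "\<forall>x\<in>set xs. cstar x = x" and say: "\<forall>y\<in>set ys. cstar y = y"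
    and genx: "generates_cstar (set xs)" and geny: "generates_cstar (set ys)"
    and \<omega>: "\<omega> > 0" and R: "R > 0"
  obtains \<omega>\<^sub>0 R' where "\<omega>\<^sub>0 > 0" "R' > 0"
    "\<And>\<omega>' \<epsilon>' r'. 0 < \<omega>' \<Longrightarrow> \<omega>' < \<omega>\<^sub>0 \<Longrightarrow> \<epsilon>' > 0 \<Longrightarrow> \<exists>\<epsilon>>0. \<exists>r\<ge>1. \<forall>k>0.
       orbit_cover_num k (Gamma_top ys [] R k \<epsilon> r) \<omega>
         \<le> orbit_cover_num k (Gamma_top xs [] R' k \<epsilon>' r') \<omega>'"
proof -
  define n where "n = length xs"
  define p where "p = length ys"
  \<comment> \<open>The final estimate is \<open>6 * \<delta>\<close> per coordinate, and
    \<open>orbit_ballI\<close> multiplies it by \<open>p\<close>. The summand 1 covers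
    \<open>p = 0\<close>.\<close>
  define \<delta> where "\<delta> = \<omega> / (8 * (real p + 1))"
  have \<delta>: "\<delta> > 0" using \<omega> by (simp add: \<delta>_def)
  have "8 * (real p + 1) * \<delta> = \<omega>" by (simp add: \<delta>_def)
  then have "8 * (real p * \<delta>) + 8 * \<delta> = \<omega>" by (simp add: algebra_simps)
  moreover have "0 \<le> real p * \<delta>" using \<delta> by simp
  ultimately have "6 * (real p * \<delta>) < \<omega>" using \<delta> by linarith
  then have p\<delta>: "real p * (6 * \<delta>) < \<omega>" by (simp add: mult.left_commute)
  have "\<exists>t. nc_valid n t \<and> norm (nc_eval t xs - ys ! j) < \<delta>" for j
    using nc_eval_dense[OF sax genx \<delta>, of "ys ! j"] unfolding n_def by metis
  then obtain Q where Q: "\<And>j. nc_valid n (Q j)" "\<And>j. norm (nc_eval (Q j) xs - ys ! j) < \<delta>"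
    by metis
  \<comment> \<open>The margin 1 absorbs two errors of 1/2: from \<open>S(y)\<close> to
    \<open>x\<close>, and from the microstate norm of \<open>S\<close> to the norm of
    \<open>S(y)\<close>.\<close>
  define R' where "R' = 1 + (\<Sum>i<n. norm (xs ! i))"
  have R': "R' > 0" "R' \<ge> 0" unfolding R'_def by (simp_all add: sum_nonneg add_pos_nonneg)
  have R'_ge: "norm (xs ! i) + 1 \<le> R'" if "i < n" for i
    unfolding R'_def using that member_le_sum[of i "{..<n}" "\<lambda>i. norm (xs ! i)"] by simp
  have "\<exists>C\<ge>0. nc_lipschitz n R' C (Q j)" for j
    using nc_lipschitz_exists[OF Q(1) R'(2)] .
  then obtain c where c: "\<And>j. c j \<ge> 0" "\<And>j. nc_lipschitz n R' (c j) (Q j)"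
    by metis
  define C where "C = (\<Sum>j<p. c j)"
  have C: "C \<ge> 0" unfolding C_def using c(1) by (simp add: sum_nonneg)
  have lip: "nc_lipschitz n R' C (Q j)" if "j < p" for j
    using nc_lipschitz_mono[OF c(2)] member_le_sum[of j "{..<p}" c] c(1) that by (simp add: C_def)
  \<comment> \<open>The condition on \<open>\<omega>'\<close> is the threshold at which
    \<open>Q\<close> turns a distance of \<open>2 * \<omega>'\<close> into at most
    \<open>2 * \<delta>\<close>; the summand 1 allows \<open>C = 0\<close>.\<close>
  have key: "\<exists>\<epsilon>>0. \<exists>r\<ge>1. \<forall>k>0. orbit_cover_num k (Gamma_top ys [] R k \<epsilon> r) \<omega>
      \<le> orbit_cover_num k (Gamma_top xs [] R' k \<epsilon>' r') \<omega>'"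
    if \<omega>': "0 < \<omega>'" "\<omega>' < \<delta> / (C + 1)" and \<epsilon>': "\<epsilon>' > 0" for \<omega>' \<epsilon>' :: real and r' :: nat
  proof -
    have "(C + 1) * \<omega>' < \<delta>" using \<omega>' C by (simp add: pos_less_divide_eq mult.commute)
    then have C\<omega>': "C * \<omega>' \<le> \<delta>" using \<omega>'(1) by (simp add: distrib_right)
    have "\<exists>t. nc_valid n t \<and> Ppoly n j = coeff_fun (nc_monoms t)" for j
      using Ppoly_term by metis
    then obtain P where P: "\<And>j. nc_valid n (P j)" "\<And>j. Ppoly n j = coeff_fun (nc_monoms (P j))"
      by metis
    \<comment> \<open>A sequence of approximations is taken, so that continuity of the finitely many
      \<open>P j\<close> and \<open>Q j\<close> yields one index \<open>m\<close> meeting all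
      requirements at once.\<close>
    have "\<exists>t. i < n \<longrightarrow> nc_selfadjoint p t \<and> norm (nc_eval t ys - xs ! i) < inverse (real (Suc m))" for m i
    proof (cases "i < n")
      case True
      then have "cstar (xs ! i) = xs ! i" using sax by (simp add: n_def)
      with nc_eval_dense_selfadjoint[OF say geny, of "inverse (real (Suc m))" "xs ! i"]
      show ?thesis unfolding p_def by (metis inverse_positive_iff_positive of_nat_0_less_iff zero_less_Suc)
    qed simp
    note S_ex = this
    define S where "S m i = (SOME t. i < n \<longrightarrow> nc_selfadjoint p t \<and>
      norm (nc_eval t ys - xs ! i) < inverse (real (Suc m)))" for m i
    have S: "nc_selfadjoint p (S m i)" "norm (nc_eval (S m i) ys - xs ! i) < inverse (real (Suc m))"
      if "i < n" for m i
      using someI_ex[OF S_ex[of i m]] that unfolding S_def by blast+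
    define zs where "zs m = map (\<lambda>i. nc_eval (S m i) ys) [0..<n]" for m
    have lim: "(\<lambda>m. zs m ! i) \<longlonglongrightarrow> xs ! i" if "i < n" for i
    proof (rule LIM_zero_cancel, rule Lim_null_comparison[OF _ LIMSEQ_inverse_real_of_nat])
      show "\<forall>\<^sub>F m in sequentially. norm (zs m ! i - xs ! i) \<le> inverse (real (Suc m))"
        using S(2)[OF that] that by (intro always_eventually) (auto simp: zs_def less_imp_le)
    qed
    have lim_eval: "(\<lambda>m. nc_eval t (zs m)) \<longlonglongrightarrow> nc_eval t xs" if "nc_valid n t" for t
      using that lim by (rule tendsto_nc_eval)
    have ev: "\<forall>\<^sub>F m in sequentially. norm (f m - l) < e"
      if "f \<longlonglongrightarrow> l" "e > 0" for f :: "nat \<Rightarrow> 'a" and l e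
      using tendstoD[OF that] by (simp add: dist_norm)
    have "\<forall>\<^sub>F m in sequentially. (\<forall>i\<in>{..<n}. norm (zs m ! i - xs ! i) < 1/2)"
      by (intro eventually_ball_finite ballI ev lim) auto
    moreover have "\<forall>\<^sub>F m in sequentially. (\<forall>j\<in>{1..r'}. norm (nc_eval (P j) (zs m) - nc_eval (P j) xs) < \<epsilon>' / 2)"
      using \<epsilon>' by (intro eventually_ball_finite ballI ev lim_eval P(1)) auto
    \<comment> \<open>The tolerance is the slack left by the strict bound \<open>Q(2)\<close>, so
      \<open>Q j (zs m)\<close> remains within \<open>\<delta>\<close> of
      \<open>ys ! j\<close>.\<close>
    moreover have "\<forall>\<^sub>F m in sequentially. (\<forall>j\<in>{..<p}.
        norm (nc_eval (Q j) (zs m) - nc_eval (Q j) xs) < \<delta> - norm (nc_eval (Q j) xs - ys ! j))"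
      using Q(2) by (intro eventually_ball_finite ballI ev lim_eval Q(1)) auto
    ultimately have "\<forall>\<^sub>F m in sequentially. (\<forall>i\<in>{..<n}. norm (zs m ! i - xs ! i) < 1/2) \<and>
        (\<forall>j\<in>{1..r'}. norm (nc_eval (P j) (zs m) - nc_eval (P j) xs) < \<epsilon>' / 2) \<and>
        (\<forall>j\<in>{..<p}. norm (nc_eval (Q j) (zs m) - nc_eval (Q j) xs) < \<delta> - norm (nc_eval (Q j) xs - ys ! j))"
      by (intro eventually_conj)
    from eventually_happens'[OF sequentially_bot this]
    obtain m where m: "\<And>i. i \<in> {..<n} \<Longrightarrow> norm (zs m ! i - xs ! i) < 1/2"
      "\<And>j. j \<in> {1..r'} \<Longrightarrow> norm (nc_eval (P j) (zs m) - nc_eval (P j) xs) < \<epsilon>' / 2"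
      "\<And>j. j \<in> {..<p} \<Longrightarrow> norm (nc_eval (Q j) (zs m) - nc_eval (Q j) xs) < \<delta> - norm (nc_eval (Q j) xs - ys ! j)"
      by blast
    have Qm: "norm (nc_eval (Q j) (zs m) - ys ! j) < \<delta>" if "j < p" for j
      using norm_triangle_ineq[of "nc_eval (Q j) (zs m) - nc_eval (Q j) xs" "nc_eval (Q j) xs - ys ! j"] m(3)[of j] that
      by simp
    define ss where "ss = map (S m) [0..<n]"
    have len_ss: "length ss = n" by (simp add: ss_def)
    have ss: "nc_selfadjoint p s" if "s \<in> set ss" for s using that S(1) by (auto simp: ss_def)
    have ss_valid: "\<forall>s\<in>set ss. nc_valid p s" using ss by (simp add: nc_selfadjoint_def)
    have zs_ss: "zs m = map (\<lambda>s. nc_eval s ys) ss" by (simp add: zs_def ss_def)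
    define E where "E j = Add (nc_subst ss (Q j)) (Mul (Const (- 1)) (Var j))" for j
    \<comment> \<open>The three families control, in this order, the norm bound \<open>R'\<close> on
      the images, the conditions \<open>P j\<close> defining microstates of \<open>xs\<close>, and
      the operator norm of \<open>Q \<circ> S - Y\<close>.\<close>
    define T where "T = set ss \<union> (\<lambda>j. nc_subst ss (P j)) ` {1..r'} \<union> E ` {..<p}"
    have validT: "nc_valid p t" if "t \<in> T" for t
      using that ss_valid P(1) Q(1) complex_rats_closed(2) complex_rats_closed(6)[of 1]
      by (auto simp: T_def E_def len_ss intro!: nc_valid_subst)
    obtain r where r: "r \<ge> 1" "\<And>R k \<epsilon> Bs t. Bs \<in> Gamma_top ys [] R k \<epsilon> r \<Longrightarrow> t \<in> T \<Longrightarrow>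
        \<bar>mat_opnorm (nc_mat k t Bs) - norm (nc_eval t ys)\<bar> \<le> \<epsilon>"
      using Gamma_top_term_bound[of T ys] validT unfolding p_def by (auto simp: T_def)
    \<comment> \<open>One bound for each family in \<open>T\<close>: each tolerance is half spent on
      the algebra side and half on the matrix side, with \<open>\<delta>\<close> being half of the
      \<open>2 * \<delta>\<close> in \<open>almost_id\<close>.\<close>
    define \<epsilon> where "\<epsilon> = min (1/2) (min (\<epsilon>' / 2) \<delta>)"
    have \<epsilon>: "\<epsilon> > 0" "\<epsilon> \<le> 1/2" "\<epsilon> \<le> \<epsilon>' / 2" "\<epsilon> \<le> \<delta>" using \<epsilon>' \<delta> by (auto simp: \<epsilon>_def)
    have "orbit_cover_num k (Gamma_top ys [] R k \<epsilon> r) \<omega>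
        \<le> orbit_cover_num k (Gamma_top xs [] R' k \<epsilon>' r') \<omega>'" if k: "k > 0" for k
    proof -
      let ?Y = "Gamma_top ys [] R k \<epsilon> r" and ?X = "Gamma_top xs [] R' k \<epsilon>' r'"
      define g where "g Bs = map (\<lambda>s. nc_mat k s Bs) ss" for Bs
      have X: "length As = n \<and> (\<forall>A\<in>set As. hs_bounded k R' A)" if "As \<in> ?X" for As
        using that by (auto simp: Gamma_top_Nil n_def intro: hs_bounded_msa)
      have Y: "length Bs = p" "set Bs \<subseteq> msa k" "set Bs \<subseteq> carrier_mat k k" if "Bs \<in> ?Y" for Bs
        using that by (auto simp: Gamma_top_Nil p_def dest: msa_carrier)
      have gX: "g Bs \<in> ?X" if B: "Bs \<in> ?Y" for Bs
      proof -
        note Bs = Y[OF B]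
        have msa: "set (g Bs) \<subseteq> msa k" using ss Bs by (auto simp: g_def nc_selfadjoint_def)
        have car: "set (g Bs) \<subseteq> carrier_mat k k" using msa by (auto dest: msa_carrier)
        have len: "length (g Bs) = n" by (simp add: g_def len_ss)
        have "mat_opnorm M \<le> R'" if "M \<in> set (g Bs)" for M
        proof -
          obtain i where i: "i < n" "M = nc_mat k (S m i) Bs" using \<open>M \<in> set (g Bs)\<close>
            by (auto simp: g_def ss_def)
          have "S m i \<in> T" using i by (auto simp: T_def ss_def)
          then have "mat_opnorm M \<le> norm (nc_eval (S m i) ys) + 1/2"
            using r(2)[OF B] i \<epsilon>(2) by fastforce
          also have "nc_eval (S m i) ys = zs m ! i" using i by (simp add: zs_def)
          also have "norm (zs m ! i) \<le> norm (xs ! i) + 1/2"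
            using m(1)[of i] i(1) norm_triangle_sub[of "zs m ! i" "xs ! i"] by simp
          finally show ?thesis using R'_ge[OF i(1)] by simp
        qed
        moreover have "\<bar>mat_opnorm (eval_mat k (Ppoly n j) (g Bs)) - norm (eval_alg (Ppoly n j) xs)\<bar> \<le> \<epsilon>'"
          if j: "j \<in> {1..r'}" for j
        proof -
          have "nc_subst ss (P j) \<in> T" using j by (auto simp: T_def)
          from r(2)[OF B this]
          have "\<bar>mat_opnorm (nc_mat k (P j) (g Bs)) - norm (nc_eval (P j) (zs m))\<bar> \<le> \<epsilon>"
            using P(1) by (simp add: nc_mat_subst nc_eval_subst len_ss g_def zs_ss)
          moreover have "\<bar>norm (nc_eval (P j) (zs m)) - norm (nc_eval (P j) xs)\<bar> < \<epsilon>' / 2"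
            using m(2)[OF j] norm_triangle_ineq3 le_less_trans by blast
          ultimately have "\<bar>mat_opnorm (nc_mat k (P j) (g Bs)) - norm (nc_eval (P j) xs)\<bar> \<le> \<epsilon>'"
            using \<epsilon>(3) by linarith
          then show ?thesis using P car len by (simp add: eval_alg_coeff_fun eval_mat_coeff_fun)
        qed
        ultimately show ?thesis using msa len by (auto simp: Gamma_top_Nil n_def)
      qed
      have almost_id: "hs_norm k (Bs ! j - nc_mat k (Q j) (g Bs)) \<le> 2 * \<delta>"
        if B: "Bs \<in> ?Y" and j: "j < p" for Bs j
      proof -
        note Bs = Y[OF B]
        have car: "set (g Bs) \<subseteq> carrier_mat k k" using gX[OF B] by (auto simp: Gamma_top_Nil dest: msa_carrier)
        have c: "nc_mat k (Q j) (g Bs) \<in> carrier_mat k k"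
          using car Q(1) by (intro nc_mat_carrier) (auto simp: g_def len_ss)
        have cj: "Bs ! j \<in> carrier_mat k k" using Bs j by auto
        have "E j \<in> T" using j by (auto simp: T_def)
        have "nc_mat k (E j) Bs = nc_mat k (Q j) (g Bs) - Bs ! j"
          using Q(1) nc_mat_minus_Var[OF c cj] by (simp add: E_def nc_mat_subst len_ss g_def)
        moreover have "nc_eval (E j) ys = nc_eval (Q j) (zs m) - ys ! j"
        proof -
          have "scaleC (- 1) (1::'a) = - 1" using scaleC_of_real[of "-1" "1::'a"] by simp
          then show ?thesis using Q(1) by (simp add: E_def nc_eval_subst len_ss zs_ss)
        qed
        ultimately have "\<bar>mat_opnorm (nc_mat k (Q j) (g Bs) - Bs ! j) - norm (nc_eval (Q j) (zs m) - ys ! j)\<bar> \<le> \<epsilon>"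
          using r(2)[OF B \<open>E j \<in> T\<close>] by simp
        then have "mat_opnorm (nc_mat k (Q j) (g Bs) - Bs ! j) \<le> 2 * \<delta>"
          using Qm[OF j] \<epsilon>(4) by linarith
        moreover have "hs_norm k (nc_mat k (Q j) (g Bs) - Bs ! j) \<le> mat_opnorm (nc_mat k (Q j) (g Bs) - Bs ! j)"
          using c cj k by (intro hs_norm_le_opnorm) auto
        ultimately show ?thesis using hs_norm_minus_commute[OF c cj] by simp
      qed
      have close: "Bs \<in> orbit_ball k \<omega> Bs'"
        if B: "Bs \<in> ?Y" and B': "Bs' \<in> ?Y" and A: "As \<in> ?X"
          and g1: "g Bs \<in> orbit_ball k \<omega>' As" and g2: "g Bs' \<in> orbit_ball k \<omega>' As" for Bs Bs' As
      proof -
        have cA: "set As \<subseteq> carrier_mat k k" "length As = n"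
          using X[OF A] by (auto dest: hs_bounded_carrier)
        obtain V where V: "unitary_mat k V" "\<And>i. i < n \<Longrightarrow> hs_norm k (g Bs ! i - conj_mat V (As ! i)) < \<omega>'"
          using orbit_ballD[OF g1 cA(1)] cA(2) by metis
        obtain W where W: "unitary_mat k W" "\<And>i. i < n \<Longrightarrow> hs_norm k (g Bs' ! i - conj_mat W (As ! i)) < \<omega>'"
          using orbit_ballD[OF g2 cA(1)] cA(2) by metis
        \<comment> \<open>\<open>U\<close> carries the \<open>W\<close>-conjugate of the centre
          \<open>As\<close> to its \<open>V\<close>-conjugate, so the centre drops out and
          \<open>g Bs\<close> is compared directly with a conjugate of \<open>g Bs'\<close>.\<close>
        define U where "U = V * mat_adjoint W"
        have U: "unitary_mat k U" unfolding U_def using V(1) W(1) by (intro unitary_mat_mult unitary_mat_adjoint)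
        note cU = unitary_mat_carrier[OF U] unitary_mat_carrier[OF V(1)] unitary_mat_carrier[OF W(1)]
        have cB: "set Bs \<subseteq> carrier_mat k k" "set Bs' \<subseteq> carrier_mat k k" "length Bs = p" "length Bs' = p"
          using Y[OF B] Y[OF B'] by auto
        have hb: "\<forall>M\<in>set (g Bs) \<union> set (g Bs'). hs_bounded k R' M"
          using X[OF gX[OF B]] X[OF gX[OF B']] by blast
        have cg: "set (g Bs) \<subseteq> carrier_mat k k" "set (g Bs') \<subseteq> carrier_mat k k"
          using hb by (auto dest: hs_bounded_carrier)
        have lg: "length (g Bs) = n" "length (g Bs') = n" by (auto simp: g_def len_ss)
        have step: "hs_norm k (g Bs ! i - map (conj_mat U) (g Bs') ! i) \<le> 2 * \<omega>'" if i: "i < n" for i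
        proof -
          have c: "g Bs ! i \<in> carrier_mat k k" "g Bs' ! i \<in> carrier_mat k k" "As ! i \<in> carrier_mat k k"
            using cg lg cA i by (auto simp: subset_iff)
          note c' = conj_mat_carrier[OF cU(2) c(3)] conj_mat_carrier[OF cU(1) c(2)]
            conj_mat_carrier[OF cU(3) c(3)]
          have "U * W = V * (mat_adjoint W * W)"
            unfolding U_def using cU mat_adjoint_carrier[OF cU(3)] by (simp add: assoc_mult_mat[of _ k k _ k _ k])
          also have "\<dots> = V" using W(1) cU by (simp add: unitary_mat_def)
          finally have "conj_mat V (As ! i) = conj_mat U (conj_mat W (As ! i))"
            using cU c by (simp add: conj_mat_conj_mat)
          then have "conj_mat V (As ! i) - conj_mat U (g Bs' ! i) = conj_mat U (conj_mat W (As ! i) - g Bs' ! i)"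
            using cU c c' by (simp add: conj_mat_minus)
          then have "hs_norm k (conj_mat V (As ! i) - conj_mat U (g Bs' ! i)) = hs_norm k (g Bs' ! i - conj_mat W (As ! i))"
            using U c c' by (simp add: hs_norm_conj_mat hs_norm_minus_commute)
          then show ?thesis
            using hs_norm_triangle[OF c(1) c'(1) c'(2)] V(2)[OF i] W(2)[OF i] i lg by simp
        qed
        show ?thesis
        proof (rule orbit_ballI[OF _ cB(1,2) U])
          show "length Bs = length Bs'" using cB by simp
          show "real (length Bs') * (6 * \<delta>) < \<omega>" using p\<delta> cB by simp
          fix j assume "j < length Bs'"
          then have j: "j < p" using cB by simp
          let ?q = "nc_mat k (Q j) (g Bs)" and ?q' = "nc_mat k (Q j) (g Bs')"
          have c: "?q \<in> carrier_mat k k" "?q' \<in> carrier_mat k k" "Bs ! j \<in> carrier_mat k k" "Bs' ! j \<in> carrier_mat k k"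
            using Q(1) cg lg cB j by (auto intro!: nc_mat_carrier simp: subset_iff)
          note c' = conj_mat_carrier[OF cU(1) c(2)] conj_mat_carrier[OF cU(1) c(4)]
          have "\<forall>M\<in>set (g Bs) \<union> set (map (conj_mat U) (g Bs')). hs_bounded k R' M"
            using hb hs_bounded_conj_mat[OF U _ R'(2)] by auto
          then have "hs_norm k (?q - nc_mat k (Q j) (map (conj_mat U) (g Bs'))) \<le> C * (2 * \<omega>')"
            using lip[OF j, unfolded nc_lipschitz_def] step lg \<omega>'(1) by simp
          then have 1: "hs_norm k (?q - conj_mat U ?q') \<le> 2 * \<delta>"
            using nc_mat_conj_mat[OF U, of "g Bs'" "Q j"] Q(1) lg cg C\<omega>' by simp
          have "hs_norm k (conj_mat U ?q' - conj_mat U (Bs' ! j)) = hs_norm k (Bs' ! j - ?q')"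
            using c U cU by (simp add: hs_norm_conj_mat hs_norm_minus_commute flip: conj_mat_minus)
          then have 2: "hs_norm k (conj_mat U ?q' - conj_mat U (Bs' ! j)) \<le> 2 * \<delta>"
            using almost_id[OF B' j] by simp
          \<comment> \<open>Three legs of at most \<open>2 * \<delta>\<close>: from
            \<open>Bs ! j\<close> to \<open>?q\<close>, from \<open>?q\<close> to the conjugate of
            \<open>?q'\<close>, and from there to the conjugate of \<open>Bs' ! j\<close>.\<close>
          show "hs_norm k (Bs ! j - conj_mat U (Bs' ! j)) \<le> 6 * \<delta>"
            using hs_norm_triangle[OF c(3) c(1) c'(2)] hs_norm_triangle[OF c(1) c'] almost_id[OF B j] 1 2 by linarith
        qed
      qed
      obtain F where "finite F" "F \<subseteq> ?X" "?X \<subseteq> (\<Union>A\<in>F. orbit_ball k \<omega>' A)"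
        using finite_orbit_cover_exists[of ?X n k R' \<omega>'] X k \<omega>'(1) by blast
      then show ?thesis using gX close by (intro orbit_cover_num_pullback[where g = g]) blast+
    qed
    with \<epsilon>(1) r(1) show ?thesis by blast
  qed
  show ?thesis
  proof (rule that)
    show "\<delta> / (C + 1) > 0" using \<delta> C by simp
    show "R' > 0" by (rule R'(1))
  qed (rule key)
qed

lemma elog_mono: "N \<le> M \<Longrightarrow> elog N \<le> elog M"
  by (auto simp: elog_def)

text \<open>At a fixed \<open>\<omega>\<close> the quantity for \<open>ys\<close> is bounded by the
  one for \<open>xs\<close> at every sufficiently small \<open>\<omega>'\<close>, hence by its upper
  limit. Monotonicity in the radius does not enter.\<close>

lemma K_top_le:
  fixes xs ys :: "'a::cstar_algebra list"
  assumes "\<forall>x\<in>set xs. cstar x = x" "\<forall>y\<in>set ys. cstar y = y"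
    and "generates_cstar (set xs)" "generates_cstar (set ys)"
  shows "K_top ys \<le> K_top xs"
proof -
  define L where "L zs R \<omega> p = limsup (\<lambda>k. elog (orbit_cover_num k (Gamma_top zs [] R k (fst p) (snd p)) \<omega>)
      / ereal (real k ^ 2))" for zs :: "'a list" and R \<omega> :: real and p :: "real \<times> nat"
  have K: "K_top_rel_omega zs [] \<omega> = (SUP R\<in>{0<..}. INF p\<in>{0<..} \<times> {1..}. L zs R \<omega> p)" for zs :: "'a list" and \<omega>
    by (simp add: K_top_rel_omega_def L_def)
  have "K_top_rel_omega ys [] \<omega> \<le> K_top xs" if \<omega>: "\<omega> > 0" for \<omega>
    unfolding K
  proof (rule SUP_least)
    fix R :: real assume "R \<in> {0<..}"
    then have "R > 0" by simp
    obtain \<omega>\<^sub>0 R' where "\<omega>\<^sub>0 > 0" "R' > 0" and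
      cover: "\<And>\<omega>' \<epsilon>' r'. 0 < \<omega>' \<Longrightarrow> \<omega>' < \<omega>\<^sub>0 \<Longrightarrow> \<epsilon>' > 0 \<Longrightarrow> \<exists>\<epsilon>>0. \<exists>r\<ge>1. \<forall>k>0.
       orbit_cover_num k (Gamma_top ys [] R k \<epsilon> r) \<omega>
         \<le> orbit_cover_num k (Gamma_top xs [] R' k \<epsilon>' r') \<omega>'"
      using orbit_cover_num_Gamma_top_le[OF assms \<omega> \<open>R > 0\<close>] by metis
    have "(INF p\<in>{0<..} \<times> {1..}. L ys R \<omega> p) \<le> K_top_rel_omega xs [] \<omega>'"
      if \<omega>': "0 < \<omega>'" "\<omega>' < \<omega>\<^sub>0" for \<omega>'
    proof -
      have "(INF p\<in>{0<..} \<times> {1..}. L ys R \<omega> p) \<le> (INF p\<in>{0<..} \<times> {1..}. L xs R' \<omega>' p)"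
      proof (rule INF_mono)
        fix q :: "real \<times> nat" assume "q \<in> {0<..} \<times> {1..}"
        then have "fst q > 0" by auto
        from cover[OF \<omega>' this, of "snd q"] obtain \<epsilon> r where "\<epsilon> > 0" "r \<ge> 1" and
          le: "\<And>k. k > 0 \<Longrightarrow> orbit_cover_num k (Gamma_top ys [] R k \<epsilon> r) \<omega>
           \<le> orbit_cover_num k (Gamma_top xs [] R' k (fst q) (snd q)) \<omega>'"
          by blast
        have "L ys R \<omega> (\<epsilon>, r) \<le> L xs R' \<omega>' q"
          unfolding L_def
        \<comment> \<open>The covering inequality is available for \<open>k > 0\<close> only, which
          is enough for an upper limit at infinity.\<close>
        proof (rule Limsup_mono, rule eventually_mono[OF eventually_gt_at_top[of 0]])
          fix k :: nat assume "k > 0"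
          then show "elog (orbit_cover_num k (Gamma_top ys [] R k (fst (\<epsilon>, r)) (snd (\<epsilon>, r))) \<omega>) / ereal (real k ^ 2)
            \<le> elog (orbit_cover_num k (Gamma_top xs [] R' k (fst q) (snd q)) \<omega>') / ereal (real k ^ 2)"
            using le by (intro ereal_divide_right_mono elog_mono) auto
        qed
        then show "\<exists>p\<in>{0<..} \<times> {1..}. L ys R \<omega> p \<le> L xs R' \<omega>' q"
          using \<open>\<epsilon> > 0\<close> \<open>r \<ge> 1\<close> by (intro bexI[of _ "(\<epsilon>, r)"]) auto
      qed
      also have "\<dots> \<le> K_top_rel_omega xs [] \<omega>'"
        unfolding K using \<open>R' > 0\<close> by (intro SUP_upper) simp
      finally show ?thesis .
    qed
    then have "\<forall>\<^sub>F \<omega>' in at_right 0. (INF p\<in>{0<..} \<times> {1..}. L ys R \<omega> p) \<le> K_top_rel_omega xs [] \<omega>'"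
      using eventually_at_right_real[OF \<open>\<omega>\<^sub>0 > 0\<close>] by (auto elim: eventually_mono)
    then show "(INF p\<in>{0<..} \<times> {1..}. L ys R \<omega> p) \<le> K_top xs"
      unfolding K_top_def K_top_rel_def by (intro le_Limsup) auto
  qed
  then have "\<forall>\<^sub>F \<omega> in at_right 0. K_top_rel_omega ys [] \<omega> \<le> K_top xs"
    using eventually_at_right_less[of "0::real"] by (auto elim: eventually_mono)
  then show ?thesis unfolding K_top_def[of ys] K_top_rel_def by (rule Limsup_bounded)
qed

theorem theorem3p2:
  fixes xs ys :: "'a::cstar_algebra list"
  assumes "\<forall>x\<in>set xs. cstar x = x"
    and "\<forall>y\<in>set ys. cstar y = y"
    and "generates_cstar (set xs)"
    and "generates_cstar (set ys)"
  shows "K_top xs = K_top ys"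
  using assms by (intro antisym K_top_le)

end
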